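(* Fix $\nu\ge1$. Let $G$ be a connected negative definite plumbing graph (a tree with zero genus decorations). If $G$ has $\nu$ bad vertices, then $\mathbb H^q(G,k)=0$ for every $q\ge\nu$ and every $k\in\mathrm{Char}$.
   Context: Graph and lattice. $G$ is a connected negative definite plumbing graph, a tree with all genus decorations zero (equivalently, the associated plumbed 3-manifold is a rational homology sphere), with vertex set $\mathcal J$, $s=|\mathcal J|$. $L=\bigoplus_{j\in\mathcal J}\mathbb Z E_j$ carries the negative definite form with $(E_j,E_j)=e_j$ the Euler decoration, $(E_i,E_j)=1$ if $i\neq j$ are adjacent and $0$ otherwise. $L'=\{l'\in L\otimes\mathbb Q:(l',L)\subseteq\mathbb Z\}$. $\mathrm{Char}=\{k\in L':(k,x)+(x,x)\in2\mathbb Z\ \forall x\in L\}$. $k_{can}\in L'$ is defined by $(k_{can},E_j)=-(E_j,E_j)-2$ for all $j$. For $k\in\mathrm{Char}$, $\chi_k(l)=-(l,l+k)/2$ for $l\in L$; $\chi_{can}:=\chi_{k_{can}}$. Bad vertices. A connected negative definite graph is rational if $\chi_{can}(l)>0$ for every $l\in L$, $l>0$ (i.e. $l\neq0$ with all coefficients $\ge0$). $G$ has $\nu$ bad vertices if there is a subset of $\nu$ vertices such that replacing their decorations $e_j$ by some integers $e'_j\le e_j$ gives a rational graph. Lattice cohomology. $\mathcal T_0^+=\mathbb Z[U,U^{-1}]/U\mathbb Z[U]$, graded by $\deg U^{-d}=2d$. Decompose $\mathbb R^s=L\otimes\mathbb R$ into unit cubes: the cube $(l,I)$, $l\in L$,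 $I\subseteq\mathcal J$, $|I|=q$, is the $q$-cube with vertices $l+\sum_{j\in I'}E_j$, $I'\subseteq I$, oriented by a fixed order of the basis. $\mathcal C_q$ is the free $\mathbb Z$-module on oriented $q$-cubes. Put $w(\square)=\max\{\chi_k(v): v \text{ vertex of }\square\}$ and $\mathcal F^q=\mathrm{Hom}_{\mathbb Z}(\mathcal C_q,\mathcal T_0^+)$. If $\partial\square_{q+1}=\sum_m\varepsilon_m\square_q^m$, set $(\delta_w\phi)(\square_{q+1})=\sum_m\varepsilon_m U^{w(\square_{q+1})-w(\square_q^m)}\phi(\square_q^m)$. $\mathbb H^q(G,k)$ is the $q$-th cohomology of $(\mathcal F^*,\delta_w)$. *)

theory Defs
  imports Complex_Main "HOL-Library.Poly_Mapping" "HOL-Algebra.Free_Abelian_Groups"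
begin

section \<open>Plumbing graphs and their lattices\<close>

text \<open>
  All genus decorations are zero throughout, so a plumbing graph carries only its Euler
  decorations. Edges are unordered pairs of vertices.
\<close>

record 'v plumbing_graph =
  verts :: "'v set"
  edges :: "'v set set"
  euler :: "'v \<Rightarrow> int"

definition adjacent :: "('v, 'b) plumbing_graph_scheme \<Rightarrow> 'v \<Rightarrow> 'v \<Rightarrow> bool" where
  "adjacent G u v \<longleftrightarrow> {u, v} \<in> edges G"

definition graph_connected :: "('v, 'b) plumbing_graph_scheme \<Rightarrow> bool" where
  "graph_connected G \<longleftrightarrow>
     verts G \<noteq> {} \<and> (\<forall>u\<in>verts G. \<forall>v\<in>verts G. (adjacent G)\<^sup>*\<^sup>* u v)"

definition graph_cycle :: "('v, 'b) plumbing_graph_scheme \<Rightarrow> 'v list \<Rightarrow> bool" where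
  "graph_cycle G p \<longleftrightarrow>
     3 \<le> length p \<and> distinct p \<and> successively (adjacent G) p \<and> adjacent G (last p) (hd p)"

locale plumbing_tree =
  fixes G :: "('v, 'b) plumbing_graph_scheme"
  assumes finite_verts: "finite (verts G)"
    and edges_verts: "edges G \<subseteq> {{u, v} |u v. u \<in> verts G \<and> v \<in> verts G \<and> u \<noteq> v}"
    and connected: "graph_connected G"
    and acyclic: "\<not> (\<exists>p. graph_cycle G p)"

text \<open>
  The lattice \<open>L\<close> and its rational span \<open>L \<otimes> \<rat>\<close>, in coordinates with respect to the
  basis \<open>E\<^sub>j\<close>; coordinates outside the vertex set are zero.
\<close>

definition int_lattice :: "('v, 'b) plumbing_graph_scheme \<Rightarrow> ('v \<Rightarrow> int) set" where
  "int_lattice G = {l. \<forall>v. v \<notin> verts G \<longrightarrow> l v = 0}"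

definition rat_lattice :: "('v, 'b) plumbing_graph_scheme \<Rightarrow> ('v \<Rightarrow> rat) set" where
  "rat_lattice G = {x. \<forall>v. v \<notin> verts G \<longrightarrow> x v = 0}"

definition E :: "'v \<Rightarrow> 'v \<Rightarrow> int" where
  "E j = (\<lambda>i. if i = j then 1 else 0)"

definition ratv :: "('v \<Rightarrow> int) \<Rightarrow> 'v \<Rightarrow> rat" where
  "ratv l = (\<lambda>v. of_int (l v))"

definition entry :: "('v, 'b) plumbing_graph_scheme \<Rightarrow> 'v \<Rightarrow> 'v \<Rightarrow> int" where
  "entry G i j = (if i = j then euler G j else if adjacent G i j then 1 else 0)"

definition form :: "('v, 'b) plumbing_graph_scheme \<Rightarrow> ('v \<Rightarrow> rat) \<Rightarrow> ('v \<Rightarrow> rat) \<Rightarrow> rat" where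
  "form G x y = (\<Sum>i\<in>verts G. \<Sum>j\<in>verts G. x i * y j * of_int (entry G i j))"

definition negative_definite :: "('v, 'b) plumbing_graph_scheme \<Rightarrow> bool" where
  "negative_definite G \<longleftrightarrow>
     (\<forall>l\<in>int_lattice G. l \<noteq> (\<lambda>v. 0) \<longrightarrow> form G (ratv l) (ratv l) < 0)"

definition dual_lattice :: "('v, 'b) plumbing_graph_scheme \<Rightarrow> ('v \<Rightarrow> rat) set" where
  "dual_lattice G = {x \<in> rat_lattice G. \<forall>l\<in>int_lattice G. form G x (ratv l) \<in> \<int>}"

definition characteristic_elements :: "('v, 'b) plumbing_graph_scheme \<Rightarrow> ('v \<Rightarrow> rat) set" where
  "characteristic_elements G = {k \<in> dual_lattice G. \<forall>l\<in>int_lattice G.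
     \<exists>m::int. form G k (ratv l) + form G (ratv l) (ratv l) = 2 * of_int m}"

text \<open>The description is unique whenever the form is nondegenerate.\<close>

definition k_can :: "('v, 'b) plumbing_graph_scheme \<Rightarrow> 'v \<Rightarrow> rat" where
  "k_can G = (THE k. k \<in> dual_lattice G \<and>
     (\<forall>j\<in>verts G. form G k (ratv (E j)) = - form G (ratv (E j)) (ratv (E j)) - 2))"

text \<open>For characteristic \<open>k\<close> the values of \<open>chi\<close> on the lattice are integers.\<close>

definition chi :: "('v, 'b) plumbing_graph_scheme \<Rightarrow> ('v \<Rightarrow> rat) \<Rightarrow> ('v \<Rightarrow> int) \<Rightarrow> rat" where
  "chi G k l = - form G (ratv l) (\<lambda>v. ratv l v + k v) / 2"


section \<open>Rational graphs and bad vertices\<close>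

definition rational_graph :: "('v, 'b) plumbing_graph_scheme \<Rightarrow> bool" where
  "rational_graph G \<longleftrightarrow> plumbing_tree G \<and> negative_definite G \<and>
     (\<forall>l\<in>int_lattice G. l \<noteq> (\<lambda>v. 0) \<and> (\<forall>v. 0 \<le> l v) \<longrightarrow> 0 < chi G (k_can G) l)"

definition has_bad_vertices :: "('v, 'b) plumbing_graph_scheme \<Rightarrow> nat \<Rightarrow> bool" where
  "has_bad_vertices G \<nu> \<longleftrightarrow> (\<exists>B e'. B \<subseteq> verts G \<and> card B = \<nu> \<and>
     (\<forall>j\<in>B. e' j \<le> euler G j) \<and> (\<forall>j. j \<notin> B \<longrightarrow> e' j = euler G j) \<and>
     rational_graph (G\<lparr>euler := e'\<rparr>))"


section \<open>The module of coefficients\<close>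

text \<open>
  \<open>int \<Rightarrow>\<^sub>0 int\<close> is the ring of Laurent polynomials in \<open>U\<close> over the integers, the coefficient
  of \<open>U\<^sup>n\<close> in \<open>p\<close> being \<open>lookup p n\<close>. Its subgroup \<open>U\<int>[U]\<close> consists of the \<open>p\<close> all of whose
  exponents are positive.
\<close>

definition UZU_cong :: "(int \<Rightarrow>\<^sub>0 int) \<Rightarrow> (int \<Rightarrow>\<^sub>0 int) \<Rightarrow> bool" where
  "UZU_cong p q \<longleftrightarrow> Poly_Mapping.keys (p - q) \<subseteq> {0<..}"

lemma UZU_cong_iff:
  "UZU_cong p q \<longleftrightarrow> (\<forall>n\<le>0. Poly_Mapping.lookup p n = Poly_Mapping.lookup q n)"
  unfolding UZU_cong_def
  by (auto simp: subset_iff lookup_minus in_keys_iff) (metis not_less)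

quotient_type T0 = "int \<Rightarrow>\<^sub>0 int" / UZU_cong
  by (rule equivpI) (auto simp: reflp_def symp_def transp_def UZU_cong_iff)

instantiation T0 :: ab_group_add
begin

lift_definition zero_T0 :: T0 is 0 .

lift_definition plus_T0 :: "T0 \<Rightarrow> T0 \<Rightarrow> T0" is "(+)"
  by (simp add: UZU_cong_iff lookup_add)

lift_definition minus_T0 :: "T0 \<Rightarrow> T0 \<Rightarrow> T0" is "(-)"
  by (simp add: UZU_cong_iff lookup_minus)

lift_definition uminus_T0 :: "T0 \<Rightarrow> T0" is "uminus"
  by (simp add: UZU_cong_iff)

instance
  by (intro_classes; transfer; simp add: UZU_cong_iff lookup_add lookup_minus)

end

lemma lookup_single_times:
  fixes p :: "int \<Rightarrow>\<^sub>0 int"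
  shows "Poly_Mapping.lookup (Poly_Mapping.single n c * p) m = c * Poly_Mapping.lookup p (m - n)"
  using subset_UNIV [of "Poly_Mapping.keys p"]
proof (induction p rule: frag_induction)
  case (one k)
  then show ?case
    by (auto simp: mult_single lookup_single when_def)
next
  case (diff p q)
  then show ?case
    by (simp add: right_diff_distrib lookup_minus)
qed auto

text \<open>The action of the monomial \<open>c U\<^sup>n\<close>.\<close>

lift_definition monom_act :: "int \<Rightarrow> nat \<Rightarrow> T0 \<Rightarrow> T0"
  is "\<lambda>c n p. Poly_Mapping.single (int n) c * p"
  by (simp add: UZU_cong_iff lookup_single_times)

definition T0_group :: "T0 monoid" where
  "T0_group = \<lparr>carrier = UNIV, monoid.mult = (+), one = 0\<rparr>"


section \<open>Lattice cohomology\<close>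

text \<open>
  The cube \<open>(l, I)\<close> is oriented by the order of the vertex type, so that the free group on
  the cubes \<open>(l, I)\<close> is the group of chains.
\<close>

type_synonym 'v cube = "('v \<Rightarrow> int) \<times> 'v set"

definition cubes :: "('v, 'b) plumbing_graph_scheme \<Rightarrow> nat \<Rightarrow> 'v cube set" where
  "cubes G q = {(l, I). l \<in> int_lattice G \<and> I \<subseteq> verts G \<and> card I = q}"

definition cube_verts :: "'v cube \<Rightarrow> ('v \<Rightarrow> int) set" where
  "cube_verts = (\<lambda>(l, I). {(\<lambda>v. l v + (\<Sum>j\<in>I'. E j v)) |I'. I' \<subseteq> I})"

definition weight :: "('v, 'b) plumbing_graph_scheme \<Rightarrow> ('v \<Rightarrow> rat) \<Rightarrow> 'v cube \<Rightarrow> rat" where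
  "weight G k c = Max (chi G k ` cube_verts c)"

definition boundary :: "'v::linorder cube \<Rightarrow> 'v cube \<Rightarrow>\<^sub>0 int" where
  "boundary = (\<lambda>(l, I). \<Sum>i\<in>I. frag_cmul ((- 1) ^ card {j \<in> I. j < i})
     (frag_of ((\<lambda>v. l v + E i v), I - {i}) - frag_of (l, I - {i})))"

definition chain_group ::
    "('v, 'b) plumbing_graph_scheme \<Rightarrow> nat \<Rightarrow> ('v cube \<Rightarrow>\<^sub>0 int) monoid" where
  "chain_group G q = free_Abelian_group (cubes G q)"

text \<open>
  Homomorphisms are taken to be undefined outside the chain group, so that equality of cochains
  is equality of functions; the group operation is pointwise.
\<close>

definition cochain_group ::
    "('v, 'b) plumbing_graph_scheme \<Rightarrow> nat \<Rightarrow> (('v cube \<Rightarrow>\<^sub>0 int) \<Rightarrow> T0) monoid" where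
  "cochain_group G q =
     (product_group (carrier (chain_group G q)) (\<lambda>_. T0_group))
       \<lparr>carrier := hom (chain_group G q) T0_group \<inter> extensional (carrier (chain_group G q))\<rparr>"

text \<open>
  The coboundary is given on a single cube \<open>c\<close> by the inner sum, and extended linearly to
  chains \<open>x\<close>. The weights differ by a nonnegative integer whenever \<open>k\<close> is characteristic.
\<close>

definition coboundary ::
    "('v::linorder, 'b) plumbing_graph_scheme \<Rightarrow> ('v \<Rightarrow> rat) \<Rightarrow> nat \<Rightarrow>
       (('v cube \<Rightarrow>\<^sub>0 int) \<Rightarrow> T0) \<Rightarrow> ('v cube \<Rightarrow>\<^sub>0 int) \<Rightarrow> T0" where
  "coboundary G k q \<phi> = (\<lambda>x\<in>carrier (chain_group G (Suc q)).
     \<Sum>c\<in>Poly_Mapping.keys x. monom_act (Poly_Mapping.lookup x c) 0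
       (\<Sum>d\<in>Poly_Mapping.keys (boundary c).
          monom_act (Poly_Mapping.lookup (boundary c) d) (nat \<lfloor>weight G k c - weight G k d\<rfloor>)
            (\<phi> (frag_of d))))"

definition cocycles ::
    "('v::linorder, 'b) plumbing_graph_scheme \<Rightarrow> ('v \<Rightarrow> rat) \<Rightarrow> nat \<Rightarrow>
       (('v cube \<Rightarrow>\<^sub>0 int) \<Rightarrow> T0) set" where
  "cocycles G k q = kernel (cochain_group G q) (cochain_group G (Suc q)) (coboundary G k q)"

fun coboundaries ::
    "('v::linorder, 'b) plumbing_graph_scheme \<Rightarrow> ('v \<Rightarrow> rat) \<Rightarrow> nat \<Rightarrow>
       (('v cube \<Rightarrow>\<^sub>0 int) \<Rightarrow> T0) set" where
  "coboundaries G k 0 = {\<one>\<^bsub>cochain_group G 0\<^esub>}"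
| "coboundaries G k (Suc q) = coboundary G k q ` carrier (cochain_group G q)"

text \<open>
  Only the underlying abelian group is recorded: the grading and the action of \<open>U\<close> play no
  role in vanishing statements.
\<close>

definition lattice_cohomology ::
    "('v::linorder, 'b) plumbing_graph_scheme \<Rightarrow> ('v \<Rightarrow> rat) \<Rightarrow> nat \<Rightarrow>
       (('v cube \<Rightarrow>\<^sub>0 int) \<Rightarrow> T0) set monoid" where
  "lattice_cohomology G k q =
     (cochain_group G q)\<lparr>carrier := cocycles G k q\<rparr> Mod coboundaries G k q"

end

theory Submission
  imports Defs
begin

text \<open>
  The weighted cochain complex is treated one unit cube at a time. If cubes are matched with faces of
  the same weight, a primitive of a cocycle extends across the matched cubes; no condition on the
  sublevel sets is needed, since an isomorphism between equal weights is an isomorphism in all of them.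
  Over a fixed position \<open>(i, J)\<close> in the bad coordinates, the remaining coordinates of the cube
  range over a fibre, which is exhausted by boxes whose outer layers can be matched away because the form
  is negative definite. A finite box shrinks to one vertex: as long as it is larger, rationality of
  the modified graph, applied to the difference of its extreme corners, lets one remove the lower or
  the upper layer in some good direction, or shows that some direction \<open>j \<in> J\<close> has no influence
  on the weights in the box.

  Hence only one cube of dimension \<open>card J\<close> survives over each \<open>(i, J)\<close>, so there is
  no obstruction in degrees above \<open>\<nu>\<close>. In degree \<open>\<nu>\<close> the surviving cubes form a copy of
  the top cells of the cubical lattice of rank \<open>\<nu>\<close>, and there one integrates along a line, using that
  multiplication by \<open>U\<close> is onto.
\<close>

section \<open>The coboundary of a weighted cubical complex\<close>

text \<open>The step from \<open>l\<close> to \<open>l + E v\<close> changes \<open>X\<close> by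
  \<open>c v - p l v\<close>, and \<open>p l v\<close> can only grow with the coordinates other than
  \<open>v\<close>. So a step that does not raise \<open>X\<close> at the lowest corner of a layer
  raises it nowhere in that layer; dually for the step back from the highest corner. If both tests
  fail in every direction in which a box has extent, the difference \<open>Y\<close> of its corners
  satisfies \<open>p Y v \<ge> a v v + 2\<close> on its support, and then
  \<open>\<chi>\<^sub>c\<^sub>a\<^sub>n(Y) = - (1/2) \<Sum> Y v * (p Y v - a v v - 2)\<close> is not
  positive. The bad coordinates are frozen because rationality is known only for the modified
  decorations, and these do not affect \<open>\<chi>\<^sub>c\<^sub>a\<^sub>n(Y)\<close> if
  \<open>Y\<close> has entries 0 and 1 at the bad vertices. A direction in \<open>J\<close>
  contributes just such an entry 1. It cannot be peeled off like a layer, so if the vertex found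
  lies in \<open>J\<close>, the weights are rewritten until that direction no longer occurs in
  them.\<close>

lemma monom_act_add: "monom_act a n (x + y) = monom_act a n x + monom_act a n y"
  by transfer (simp add: UZU_cong_iff distrib_left)

lemma monom_act_diff: "monom_act a n (x - y) = monom_act a n x - monom_act a n y"
  by transfer (simp add: UZU_cong_iff right_diff_distrib)

lemma monom_act_0_right [simp]: "monom_act a n 0 = 0"
  by transfer (simp add: UZU_cong_iff)

lemma monom_act_0_left [simp]: "monom_act 0 n x = 0"
  by transfer (simp add: UZU_cong_iff)

lemma monom_act_add_left: "monom_act (a + b) n x = monom_act a n x + monom_act b n x"
  by transfer (simp add: UZU_cong_iff single_add distrib_right)

lemma monom_act_minus_left: "monom_act (- a) n x = - monom_act a n x"
  by (metis add.right_inverse add_eq_0_iff monom_act_0_left monom_act_add_left)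

lemma monom_act_monom_act: "monom_act a m (monom_act b n x) = monom_act (a * b) (m + n) x"
  by transfer (simp add: UZU_cong_iff mult_single flip: mult.assoc)

lemma monom_act_1_0 [simp]: "monom_act 1 0 x = x"
  by transfer (simp add: UZU_cong_iff)

lemma monom_act_sum: "monom_act a n (sum f A) = (\<Sum>i\<in>A. monom_act a n (f i))"
  by (induction A rule: infinite_finite_induct) (auto simp: monom_act_add)

text \<open>In the Laurent polynomials \<open>U^n\<close> is invertible, and surjectivity passes to
  the quotient. This divisibility is what lets values be rescaled in the top degree.\<close>

lemma monom_act_surj: "\<exists>y. monom_act 1 n y = x"
proof (transfer fixing: n)
  fix x :: "int \<Rightarrow>\<^sub>0 int"
  have "Poly_Mapping.single (int n) 1 * (Poly_Mapping.single (- int n) 1 * x) = x"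
    by (simp add: mult_single flip: mult.assoc)
  then show "\<exists>y. UZU_cong (Poly_Mapping.single (int n) 1 * y) x"
    by (metis UZU_cong_iff)
qed

text \<open>Monotonicity along faces keeps the exponents \<open>W c - W d\<close> nonnegative, so
  \<open>nat\<close> truncates nothing. Base points are arbitrary integer functions; only the
  directions are confined to \<open>V\<close>.\<close>

locale weighted_cubes =
  fixes V :: "'v::linorder set" and W :: "'v cube \<Rightarrow> int"
  assumes finite_V: "finite V"
    and W_front: "\<And>l I i. I \<subseteq> V \<Longrightarrow> i \<in> I \<Longrightarrow> W (l, I - {i}) \<le> W (l, I)"
    and W_back: "\<And>l I i. I \<subseteq> V \<Longrightarrow> i \<in> I \<Longrightarrow> W (l(i := l i + 1), I - {i}) \<le> W (l, I)"
begin

definition sg :: "'v set \<Rightarrow> 'v \<Rightarrow> int" where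
  "sg I i = (- 1) ^ card {j \<in> I. j < i}"

definition cobd :: "('v cube \<Rightarrow> T0) \<Rightarrow> 'v cube \<Rightarrow> T0" where
  "cobd \<psi> = (\<lambda>(l, I). \<Sum>i\<in>I. monom_act (sg I i) 0
     (monom_act 1 (nat (W (l, I) - W (l(i := l i + 1), I - {i}))) (\<psi> (l(i := l i + 1), I - {i}))
      - monom_act 1 (nat (W (l, I) - W (l, I - {i}))) (\<psi> (l, I - {i}))))"

definition is_face :: "'v cube \<Rightarrow> 'v cube \<Rightarrow> bool" where
  "is_face d c \<longleftrightarrow> (\<exists>i\<in>snd c. d = (fst c, snd c - {i}) \<or>
     d = ((fst c)(i := fst c i + 1), snd c - {i}))"

lemma sg_sq: "sg I i * sg I i = 1"
  by (simp add: sg_def flip: power_mult_distrib)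

text \<open>Removing the smaller of two directions moves the larger one down by one place, while
  removing the larger leaves the smaller in place; exactly one sign flips.\<close>

lemma sg_swap:
  assumes "finite I" "i \<in> I" "j \<in> I" "i \<noteq> j"
  shows "sg I i * sg (I - {i}) j = - (sg I j * sg (I - {j}) i)"
proof -
  have *: "sg (I - {i}) j = - sg I j \<and> sg (I - {j}) i = sg I i"
    if "i < j" "i \<in> I" for i j
  proof -
    have "{k \<in> I. k < j} = insert i {k \<in> I - {i}. k < j}"
      using that by auto
    then have "card {k \<in> I. k < j} = card (insert i {k \<in> I - {i}. k < j})"
      by (rule arg_cong)
    then have "card {k \<in> I. k < j} = Suc (card {k \<in> I - {i}. k < j})"
      using \<open>finite I\<close> by (subst (asm) card_insert_disjoint) auto
    moreover have "{k \<in> I - {j}. k < i} = {k \<in> I. k < i}"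
      using that by auto
    ultimately show ?thesis
      by (simp add: sg_def)
  qed
  show ?thesis
  proof (cases "i < j")
    case True
    with *[OF True \<open>i \<in> I\<close>] show ?thesis
      by (metis mult.commute mult_minus_right)
  next
    case False
    then have "j < i"
      using \<open>i \<noteq> j\<close> by simp
    with *[OF this \<open>j \<in> I\<close>] show ?thesis
      by (metis minus_minus mult.commute mult_minus_right)
  qed
qed

lemma cobd_diff: "cobd (\<lambda>c. f c - g c) c = cobd f c - cobd g c"
  by (cases c) (auto simp: cobd_def monom_act_diff sum_subtractf[symmetric] intro!: sum.cong)

lemma cobd_cong:
  assumes "\<And>d. is_face d c \<Longrightarrow> f d = g d"
  shows "cobd f c = cobd g c"
  using assms
  by (cases c, simp only: cobd_def prod.case is_face_def fst_conv snd_conv)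
    (intro sum.cong arg_cong2[where f = "(-)"] arg_cong[where f = "monom_act _ _"] refl; blast)

lemma card_face: "is_face d c \<Longrightarrow> finite (snd c) \<Longrightarrow> Suc (card (snd d)) = card (snd c)"
  unfolding is_face_def by (elim bexE disjE) (simp_all only: snd_conv card_Suc_Diff1)

text \<open>The terms with \<open>i < j\<close> are cancelled explicitly against those with
  \<open>j < i\<close>: in a general abelian group \<open>s = - s\<close> does not give
  \<open>s = 0\<close>.\<close>

lemma sum_antisym:
  fixes A :: "'v \<Rightarrow> 'v \<Rightarrow> 'b::ab_group_add"
  assumes "finite I" and anti: "\<And>i j. i \<in> I \<Longrightarrow> j \<in> I \<Longrightarrow> i \<noteq> j \<Longrightarrow> A i j = - A j i"
  shows "(\<Sum>i\<in>I. \<Sum>j\<in>I - {i}. A i j) = 0"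
proof -
  have split: "(\<Sum>j\<in>I - {i}. A i j) = (\<Sum>j\<in>I. if i < j then A i j else 0) + (\<Sum>j\<in>I. if j < i then A i j else 0)"
    for i
  proof -
    have "(\<Sum>j\<in>I - {i}. A i j) = (\<Sum>j\<in>I. if j \<noteq> i then A i j else 0)"
      using \<open>finite I\<close> by (intro sum.mono_neutral_cong_left) auto
    also have "\<dots> = (\<Sum>j\<in>I. (if i < j then A i j else 0) + (if j < i then A i j else 0))"
      by (intro sum.cong) auto
    finally show ?thesis
      by (simp add: sum.distrib)
  qed
  have "(\<Sum>i\<in>I. \<Sum>j\<in>I. if j < i then A i j else 0) = (\<Sum>j\<in>I. \<Sum>i\<in>I. if j < i then A i j else 0)"
    by (rule sum.swap)
  also have "\<dots> = (\<Sum>j\<in>I. \<Sum>i\<in>I. - (if j < i then A j i else 0))"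
    by (intro sum.cong refl) (metis anti less_irrefl minus_zero)
  finally show ?thesis
    by (simp only: split sum.distrib sum_negf add.right_inverse)
qed

lemma cobd_cobd:
  assumes "snd c \<subseteq> V"
  shows "cobd (cobd \<psi>) c = 0"
proof -
  obtain l I where c: "c = (l, I)" by (cases c)
  have I: "I \<subseteq> V" "finite I"
    using assms finite_V by (auto simp: c finite_subset)
  \<comment> \<open>Each face of codimension two is carried directly to the weight of
    \<open>c\<close>; by monotonicity the two exponents along any route add up to this one.
    \<open>H\<close> is then a second difference, symmetric in \<open>i\<close> and
    \<open>j\<close>, and meets antisymmetric signs.\<close>
  define G where "G l' i j = monom_act 1 (nat (W (l, I) - W (l', I - {i} - {j}))) (\<psi> (l', I - {i} - {j}))"
    for l' i j
  define H where "H i j = G (l(i := l i + 1, j := l j + 1)) i j - G (l(i := l i + 1)) i j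
      - (G (l(j := l j + 1)) i j - G l i j)" for i j
  have H_sym: "H i j = H j i" if "i \<noteq> j" for i j
  proof -
    have "l(i := l i + 1, j := l j + 1) = l(j := l j + 1, i := l i + 1)" "I - {i} - {j} = I - {j} - {i}"
      using that by (auto simp: fun_upd_twist)
    then show ?thesis
      by (simp add: H_def G_def)
  qed
  have comp: "monom_act 1 (nat (W (l, I) - W d)) (cobd \<psi> d) = (\<Sum>j\<in>I - {i}. monom_act (sg (I - {i}) j) 0
      (G ((fst d)(j := fst d j + 1)) i j - G (fst d) i j))"
    if i: "i \<in> I" and d: "snd d = I - {i}" "fst d = l \<or> fst d = l(i := l i + 1)" for i d
  proof -
    have Wd: "W d \<le> W (l, I)"
      using d W_front[OF I(1) i, of l] W_back[OF I(1) i, of l] by (cases d) auto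
    have Wj: "W (fst d, I - {i} - {j}) \<le> W d" "W ((fst d)(j := fst d j + 1), I - {i} - {j}) \<le> W d"
      if "j \<in> I - {i}" for j
      using W_front[of "I - {i}" j "fst d"] W_back[of "I - {i}" j "fst d"] I that d(1)
      by (metis Diff_subset order_trans prod.collapse)+
    have G_eq: "monom_act 1 (nat (W (l, I) - W d)) (monom_act 1 (nat (W d - W (l', I - {i} - {j}))) (\<psi> (l', I - {i} - {j})))
        = G l' i j" if "W (l', I - {i} - {j}) \<le> W d" for l' j
    proof -
      have "nat (W (l, I) - W d) + nat (W d - W (l', I - {i} - {j})) = nat (W (l, I) - W (l', I - {i} - {j}))"
        using Wd that by linarith
      then show ?thesis
        by (simp add: monom_act_monom_act G_def)
    qed
    obtain l' where d': "d = (l', I - {i})"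
      using d(1) by (metis prod.collapse)
    have "monom_act 1 (nat (W (l, I) - W d)) (cobd \<psi> d) = (\<Sum>j\<in>I - {i}. monom_act (sg (I - {i}) j) 0
      (monom_act 1 (nat (W (l, I) - W d)) (monom_act 1 (nat (W d - W (l'(j := l' j + 1), I - {i} - {j}))) (\<psi> (l'(j := l' j + 1), I - {i} - {j})))
      - monom_act 1 (nat (W (l, I) - W d)) (monom_act 1 (nat (W d - W (l', I - {i} - {j}))) (\<psi> (l', I - {i} - {j})))))"
      by (simp add: d' cobd_def monom_act_sum monom_act_diff monom_act_monom_act ac_simps)
    also have "\<dots> = (\<Sum>j\<in>I - {i}. monom_act (sg (I - {i}) j) 0
      (G (l'(j := l' j + 1)) i j - G l' i j))"
      using Wj unfolding d' fst_conv by (intro sum.cong refl) (simp only: G_eq[unfolded d'])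
    finally show ?thesis
      by (simp add: d')
  qed
  have term_eq: "monom_act (sg I i) 0
     (monom_act 1 (nat (W (l, I) - W (l(i := l i + 1), I - {i}))) (cobd \<psi> (l(i := l i + 1), I - {i}))
      - monom_act 1 (nat (W (l, I) - W (l, I - {i}))) (cobd \<psi> (l, I - {i})))
     = (\<Sum>j\<in>I - {i}. monom_act (sg I i * sg (I - {i}) j) 0 (H i j))" if "i \<in> I" for i
    using comp[OF that, of "(l(i := l i + 1), I - {i})"] comp[OF that, of "(l, I - {i})"]
    by (simp add: monom_act_sum H_def monom_act_diff monom_act_monom_act flip: sum_subtractf)
  have "cobd (cobd \<psi>) c = (\<Sum>i\<in>I. \<Sum>j\<in>I - {i}. monom_act (sg I i * sg (I - {i}) j) 0 (H i j))"
    unfolding c by (subst cobd_def, simp only: prod.case) (intro sum.cong refl term_eq)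
  also have "\<dots> = 0"
  proof (intro sum_antisym)
    fix i j assume ij: "i \<in> I" "j \<in> I" "i \<noteq> j"
    show "monom_act (sg I i * sg (I - {i}) j) 0 (H i j) = - monom_act (sg I j * sg (I - {j}) i) 0 (H j i)"
      unfolding sg_swap[OF I(2) ij] H_sym[OF ij(3)] by (rule monom_act_minus_left)
  qed (fact I)
  finally show ?thesis .
qed

text \<open>Equal weights make the exponent of \<open>U\<close> zero, so \<open>d\<close> enters
  with the coefficient 1 or -1, which can be inverted.\<close>

lemma cobd_single:
  assumes face: "is_face d c" and c: "snd c \<subseteq> V" and W: "W d = W c"
    and others: "\<And>d'. is_face d' c \<Longrightarrow> d' \<noteq> d \<Longrightarrow> \<psi> d' = 0"
  shows "cobd \<psi> c = \<psi> d \<or> cobd \<psi> c = - \<psi> d"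
proof -
  obtain l I where lI: "c = (l, I)" by (cases c)
  have "finite I"
    using c finite_V by (auto simp: lI finite_subset)
  obtain i where i: "i \<in> I" and d: "d = (l, I - {i}) \<or> d = (l(i := l i + 1), I - {i})"
    using face by (auto simp: is_face_def lI)
  have zero: "\<psi> (l, I - {j}) = 0" "\<psi> (l(j := l j + 1), I - {j}) = 0" if "j \<in> I" "j \<noteq> i" for j
    using that i d by (auto intro!: others simp: is_face_def lI)
  have "cobd \<psi> c = monom_act (sg I i) 0
     (monom_act 1 (nat (W c - W (l(i := l i + 1), I - {i}))) (\<psi> (l(i := l i + 1), I - {i}))
      - monom_act 1 (nat (W c - W (l, I - {i}))) (\<psi> (l, I - {i})))"
    unfolding lI cobd_def prod.case using i \<open>finite I\<close>
    by (subst sum.remove[of _ i]) (auto simp: zero intro!: sum.neutral)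
  moreover have ne: "l(i := l i + 1) \<noteq> l"
    by (auto dest: fun_cong[of _ _ i])
  have "cobd \<psi> c = monom_act (sg I i) 0 (\<psi> d) \<or> cobd \<psi> c = monom_act (sg I i) 0 (- \<psi> d)"
    using d
  proof
    assume d: "d = (l, I - {i})"
    then have "\<psi> (l(i := l i + 1), I - {i}) = 0"
      using i ne by (intro others) (auto simp: is_face_def lI)
    then show ?thesis
      using calculation W d by simp
  next
    assume d: "d = (l(i := l i + 1), I - {i})"
    then have "\<psi> (l, I - {i}) = 0"
      using i ne by (intro others) (auto simp: is_face_def lI)
    then show ?thesis
      using calculation W d by simp
  qed
  moreover have "sg I i = 1 \<or> sg I i = - 1"
    unfolding sg_def by (metis neg_one_even_power neg_one_odd_power)
  ultimately show ?thesis
    by (auto simp: monom_act_minus_left)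
qed

section \<open>Extending primitives across matched cubes\<close>

definition closed_cubes :: "'v cube set \<Rightarrow> bool" where
  "closed_cubes X \<longleftrightarrow> (\<forall>c\<in>X. snd c \<subseteq> V \<and> (\<forall>d. is_face d c \<longrightarrow> d \<in> X))"

definition cocycle :: "nat \<Rightarrow> ('v cube \<Rightarrow> T0) \<Rightarrow> bool" where
  "cocycle q \<phi> \<longleftrightarrow> (\<forall>c. snd c \<subseteq> V \<and> card (snd c) = Suc q \<longrightarrow> cobd \<phi> c = 0)"

definition bounds_on :: "nat \<Rightarrow> 'v cube set \<Rightarrow> ('v cube \<Rightarrow> T0) \<Rightarrow> ('v cube \<Rightarrow> T0) \<Rightarrow> bool" where
  "bounds_on q X \<phi> \<psi> \<longleftrightarrow> (\<forall>c\<in>X. card (snd c) = q \<longrightarrow> cobd \<psi> c = \<phi> c)"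

text \<open>
  Every partial primitive on \<open>X\<close> of a cocycle of degree \<open>q\<close> extends to \<open>Y\<close>. This plays the
  role of the vanishing of the relative cohomology in degree \<open>q\<close>.
\<close>

definition extends :: "nat \<Rightarrow> 'v cube set \<Rightarrow> 'v cube set \<Rightarrow> bool" where
  "extends q X Y \<longleftrightarrow> (\<forall>\<phi> \<psi>. cocycle q \<phi> \<and> bounds_on q X \<phi> \<psi> \<longrightarrow>
     (\<exists>\<psi>'. (\<forall>c\<in>X. \<psi>' c = \<psi> c) \<and> bounds_on q Y \<phi> \<psi>'))"

lemma extendsD:
  assumes "extends q X Y" "cocycle q \<phi>" "bounds_on q X \<phi> \<psi>"
  obtains \<psi>' where "\<And>c. c \<in> X \<Longrightarrow> \<psi>' c = \<psi> c" "bounds_on q Y \<phi> \<psi>'"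
  using assms unfolding extends_def by blast

lemma extends_refl: "extends q X X"
  unfolding extends_def by blast

lemma extends_trans:
  assumes "extends q X Y" "extends q Y Z" "X \<subseteq> Y"
  shows "extends q X Z"
  unfolding extends_def
proof (intro allI impI, elim conjE)
  fix \<phi> \<psi> assume \<phi>: "cocycle q \<phi>" and \<psi>: "bounds_on q X \<phi> \<psi>"
  obtain \<psi>1 where 1: "\<And>c. c \<in> X \<Longrightarrow> \<psi>1 c = \<psi> c" "bounds_on q Y \<phi> \<psi>1"
    using extendsD[OF assms(1) \<phi> \<psi>] by blast
  obtain \<psi>2 where 2: "\<And>c. c \<in> Y \<Longrightarrow> \<psi>2 c = \<psi>1 c" "bounds_on q Z \<phi> \<psi>2"
    using extendsD[OF assms(2) \<phi> 1(2)] by blast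
  show "\<exists>\<psi>'. (\<forall>c\<in>X. \<psi>' c = \<psi> c) \<and> bounds_on q Z \<phi> \<psi>'"
    using 1 2 assms(3) by (metis subset_iff)
qed

lemma closed_cubesD:
  "closed_cubes X \<Longrightarrow> c \<in> X \<Longrightarrow> snd c \<subseteq> V"
  "closed_cubes X \<Longrightarrow> c \<in> X \<Longrightarrow> is_face d c \<Longrightarrow> d \<in> X"
  unfolding closed_cubes_def by blast+

lemma cobd_eq_on:
  assumes "closed_cubes X" "c \<in> X" "\<And>d. d \<in> X \<Longrightarrow> f d = g d"
  shows "cobd f c = cobd g c"
  using assms by (intro cobd_cong) (auto dest: closed_cubesD)

lemma card_valid_face: "is_face d c \<Longrightarrow> snd c \<subseteq> V \<Longrightarrow> Suc (card (snd d)) = card (snd c)"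
  using card_face finite_V finite_subset by metis

lemma cobd_solve:
  assumes "is_face d c" and "snd c \<subseteq> V" and "W d = W c"
  shows "\<exists>x. cobd (\<psi>(d := x)) c = y"
proof -
  have eq: "cobd (\<psi>(d := x)) c = cobd (\<psi>(d := 0)) c + cobd (\<lambda>e. if e = d then x else 0) c" for x
  proof -
    have "cobd (\<lambda>e. (\<psi>(d := x)) e - (if e = d then x else 0)) c = cobd (\<psi>(d := 0)) c"
      by (intro cobd_cong) auto
    then show ?thesis
      unfolding cobd_diff[of "\<psi>(d := x)"] by (simp only: diff_eq_eq)
  qed
  have pm: "cobd (\<lambda>e. if e = d then x else 0) c = x \<or> cobd (\<lambda>e. if e = d then x else 0) c = - x" for x
    using cobd_single[OF assms, of "\<lambda>e. if e = d then x else 0"] by auto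
  define z where "z = y - cobd (\<psi>(d := 0)) c"
  have "cobd (\<lambda>e. if e = d then z else 0) c = z \<or> cobd (\<lambda>e. if e = d then - z else 0) c = z"
  proof -
    have "cobd (\<lambda>e. (if e = d then z else 0) - (if e = d then z else 0)) c
      = cobd (\<lambda>e. if e = d then z else 0) c - cobd (\<lambda>e. if e = d then z else 0) c"
      by (rule cobd_diff)
    then have 0: "cobd (\<lambda>e. 0) c = 0"
      by simp
    have "cobd (\<lambda>e. 0 - (if e = d then z else 0)) c = 0 - cobd (\<lambda>e. if e = d then z else 0) c"
      by (subst cobd_diff) (simp add: 0)
    moreover have "(\<lambda>e. 0 - (if e = d then z else 0)) = (\<lambda>e. if e = d then - z else 0)"
      by auto
    ultimately show ?thesis
      using pm[of z] by auto
  qed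
  then obtain x where "cobd (\<lambda>e. if e = d then x else 0) c = z"
    by blast
  then have "cobd (\<psi>(d := x)) c = y"
    unfolding eq[of x] z_def by simp
  then show ?thesis ..
qed

text \<open>If \<open>t\<close> has dimension \<open>q - 1\<close>, its value is chosen to solve the
  equation at \<open>\<sigma> t\<close>; the other faces of \<open>\<sigma> t\<close> avoid
  \<open>U\<close>, so these choices are independent. If \<open>t\<close> has dimension
  \<open>q\<close>, the equation at \<open>t\<close> follows from the cocycle condition at
  \<open>\<sigma> t\<close>.\<close>

lemma extends_collapse:
  assumes X: "closed_cubes X"
    and face: "\<And>t. t \<in> U \<Longrightarrow> is_face t (\<sigma> t)"
    and valid: "\<And>t. t \<in> U \<Longrightarrow> snd (\<sigma> t) \<subseteq> V"
    and W: "\<And>t. t \<in> U \<Longrightarrow> W t = W (\<sigma> t)"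
    and others: "\<And>t d. t \<in> U \<Longrightarrow> is_face d (\<sigma> t) \<Longrightarrow> d \<noteq> t \<Longrightarrow> d \<in> X \<union> \<sigma> ` U"
    and disj: "U \<inter> X = {}" "\<sigma> ` U \<inter> U = {}"
  shows "extends q X (X \<union> U \<union> \<sigma> ` U)"
  unfolding extends_def
proof (intro allI impI, elim conjE)
  fix \<phi> \<psi> assume \<phi>: "cocycle q \<phi>" and \<psi>: "bounds_on q X \<phi> \<psi>"
  define \<psi>0 where "\<psi>0 c = (if c \<in> X then \<psi> c else 0)" for c
  define \<psi>1 where "\<psi>1 c = (if c \<in> U then SOME x. cobd (\<psi>0(c := x)) (\<sigma> c) = \<phi> (\<sigma> c) else \<psi>0 c)" for c
  have \<psi>1_X: "\<psi>1 c = \<psi> c" if "c \<in> X" for c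
    using that disj by (auto simp: \<psi>1_def \<psi>0_def)
  have onX: "cobd \<psi>1 c = \<phi> c" if "c \<in> X" "card (snd c) = q" for c
    using cobd_eq_on[OF X that(1), of \<psi>1 \<psi>] \<psi>1_X \<psi> that by (auto simp: bounds_on_def)
  have on\<sigma>: "cobd \<psi>1 (\<sigma> t) = \<phi> (\<sigma> t)" if t: "t \<in> U" for t
  proof -
    have "cobd \<psi>1 (\<sigma> t) = cobd (\<psi>0(t := \<psi>1 t)) (\<sigma> t)"
    proof (rule cobd_cong)
      fix d assume d: "is_face d (\<sigma> t)"
      show "\<psi>1 d = (\<psi>0(t := \<psi>1 t)) d"
      proof (cases "d = t")
        case False
        then have "d \<notin> U"
          using others[OF t d] disj by blast
        with False show ?thesis
          by (simp add: \<psi>1_def)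
      qed simp
    qed
    also have "\<dots> = \<phi> (\<sigma> t)"
      using someI_ex[OF cobd_solve[OF face valid W, OF t t t, of \<psi>0 "\<phi> (\<sigma> t)"]] t
      by (simp add: \<psi>1_def)
    finally show ?thesis .
  qed
  have onU: "cobd \<psi>1 t = \<phi> t" if t: "t \<in> U" and "card (snd t) = q" for t
  proof -
    \<comment> \<open>The defect \<open>\<rho>\<close> has zero coboundary at
      \<open>\<sigma> t\<close> and vanishes on every face except possibly \<open>t\<close>, which
      enters with a unit.\<close>
    define \<rho> where "\<rho> = (\<lambda>c. \<phi> c - cobd \<psi>1 c)"
    have "card (snd (\<sigma> t)) = Suc q"
      using card_valid_face[OF face valid, OF t t] that by simp
    then have "cobd \<rho> (\<sigma> t) = 0"
      using \<phi> valid[OF t] unfolding \<rho>_def cobd_diff cobd_cobd[OF valid[OF t]] cocycle_def diff_zero by blast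
    moreover have "\<rho> d = 0" if "is_face d (\<sigma> t)" "d \<noteq> t" for d
    proof -
      have "card (snd d) = q"
        using card_valid_face[OF that(1) valid[OF t]] \<open>card (snd (\<sigma> t)) = Suc q\<close> by simp
      then show ?thesis
        using others[OF t that] onX[of d] on\<sigma> by (auto simp: \<rho>_def)
    qed
    ultimately have "\<rho> t = 0"
      using cobd_single[OF face valid W, OF t t t, of \<rho>] by auto
    then show ?thesis
      by (simp add: \<rho>_def)
  qed
  show "\<exists>\<psi>'. (\<forall>c\<in>X. \<psi>' c = \<psi> c) \<and> bounds_on q (X \<union> U \<union> \<sigma> ` U) \<phi> \<psi>'"
    using \<psi>1_X onX on\<sigma> onU by (intro exI[of _ \<psi>1]) (auto simp: bounds_on_def)
qed

text \<open>A value once assigned is never revised, so each cube may read its value from the first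
  stage containing it. Closedness puts the faces of a cube into the same stage.\<close>

lemma extends_chain:
  assumes ext: "\<And>n. extends q (X n) (X (Suc n))" and closed: "\<And>n. closed_cubes (X n)"
    and mono: "\<And>n. X n \<subseteq> X (Suc n)"
  shows "extends q (X 0) (\<Union>n. X n)"
  unfolding extends_def
proof (intro allI impI, elim conjE)
  fix \<phi> \<psi> assume \<phi>: "cocycle q \<phi>" and \<psi>: "bounds_on q (X 0) \<phi> \<psi>"
  have "\<exists>f. \<forall>n. (bounds_on q (X n) \<phi> (f n) \<and> (n = 0 \<longrightarrow> f n = \<psi>)) \<and> (\<forall>c\<in>X n. f (Suc n) c = f n c)"
  proof (rule dependent_nat_choice)
    show "\<exists>x. bounds_on q (X 0) \<phi> x \<and> ((0::nat) = 0 \<longrightarrow> x = \<psi>)"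
      using \<psi> by blast
  next
    fix x n assume "bounds_on q (X n) \<phi> x \<and> (n = 0 \<longrightarrow> x = \<psi>)"
    then show "\<exists>y. (bounds_on q (X (Suc n)) \<phi> y \<and> (Suc n = 0 \<longrightarrow> y = \<psi>)) \<and> (\<forall>c\<in>X n. y c = x c)"
      using extendsD[OF ext \<phi>] by (metis nat.distinct(1))
  qed
  then obtain f where f: "\<And>n. bounds_on q (X n) \<phi> (f n)" "f 0 = \<psi>"
    "\<And>n c. c \<in> X n \<Longrightarrow> f (Suc n) c = f n c"
    by blast
  have mono': "X m \<subseteq> X n" if "m \<le> n" for m n
    using that mono by (rule lift_Suc_mono_le[rotated])
  have stable: "f n c = f m c" if "m \<le> n" "c \<in> X m" for m n c
    using that(1)
  proof (induction n rule: dec_induct)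
    case (step n)
    then show ?case
      using f(3)[of c n] mono'[of m n] that(2) by auto
  qed auto
  define g where "g c = f (LEAST n. c \<in> X n) c" for c
  have g: "g c = f n c" if "c \<in> X n" for n c
    unfolding g_def using stable[OF Least_le[of "\<lambda>n. c \<in> X n", OF that] LeastI[of "\<lambda>n. c \<in> X n", OF that]] by simp
  have "cobd g c = \<phi> c" if "c \<in> X n" "card (snd c) = q" for n c
    using cobd_eq_on[OF closed that(1), of g "f n"] g f(1)[of n] that by (simp add: bounds_on_def)
  then show "\<exists>\<psi>'. (\<forall>c\<in>X 0. \<psi>' c = \<psi> c) \<and> bounds_on q (\<Union>n. X n) \<phi> \<psi>'"
    using g f(2) by (intro exI[of _ g]) (auto simp: bounds_on_def)
qed

text \<open>No cube of one piece has a face in another, so primitives chosen separately on the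
  pieces glue.\<close>

lemma extends_family:
  assumes ext: "\<And>i. i \<in> S \<Longrightarrow> extends q X (X \<union> F i)"
    and closed: "closed_cubes X" "\<And>i. i \<in> S \<Longrightarrow> closed_cubes (X \<union> F i)"
    and disj: "\<And>i. i \<in> S \<Longrightarrow> F i \<inter> X = {}" "\<And>i j. i \<in> S \<Longrightarrow> j \<in> S \<Longrightarrow> i \<noteq> j \<Longrightarrow> F i \<inter> F j = {}"
  shows "extends q X (X \<union> (\<Union>i\<in>S. F i))"
  unfolding extends_def
proof (intro allI impI, elim conjE)
  fix \<phi> \<psi> assume \<phi>: "cocycle q \<phi>" and \<psi>: "bounds_on q X \<phi> \<psi>"
  have "\<forall>i\<in>S. \<exists>f. (\<forall>c\<in>X. f c = \<psi> c) \<and> bounds_on q (X \<union> F i) \<phi> f"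
    using ext \<phi> \<psi> by (auto simp: extends_def)
  then obtain f where f: "\<And>i c. i \<in> S \<Longrightarrow> c \<in> X \<Longrightarrow> f i c = \<psi> c"
    "\<And>i. i \<in> S \<Longrightarrow> bounds_on q (X \<union> F i) \<phi> (f i)"
    by metis
  define g where "g c = (if c \<in> X then \<psi> c else f (SOME i. i \<in> S \<and> c \<in> F i) c)" for c
  have g: "g c = f i c" if "i \<in> S" "c \<in> X \<union> F i" for i c
  proof (cases "c \<in> X")
    case False
    have "(SOME i. i \<in> S \<and> c \<in> F i) = i"
      using that False disj(2) by (intro some_equality) auto
    with False show ?thesis
      by (simp add: g_def)
  qed (use f that in \<open>simp add: g_def\<close>)
  have gX: "g c = \<psi> c" if "c \<in> X" for c
    using that by (simp add: g_def)
  have "cobd g c = \<phi> c" if "c \<in> X" "card (snd c) = q" for c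
    using cobd_eq_on[OF closed(1) that(1), of g \<psi>] gX \<psi> that by (simp add: bounds_on_def)
  moreover have "cobd g c = \<phi> c" if "i \<in> S" "c \<in> F i" "card (snd c) = q" for i c
    using cobd_eq_on[OF closed(2)[OF that(1)], of c g "f i"] g[OF that(1)] f(2)[OF that(1)] that
    by (simp add: bounds_on_def)
  ultimately show "\<exists>\<psi>'. (\<forall>c\<in>X. \<psi>' c = \<psi> c) \<and> bounds_on q (X \<union> (\<Union>i\<in>S. F i)) \<phi> \<psi>'"
    using gX by (intro exI[of _ g]) (auto simp: bounds_on_def)
qed

end

section \<open>Boxes over the bad coordinates\<close>

definition raise :: "('v \<Rightarrow> int) \<Rightarrow> 'v set \<Rightarrow> 'v \<Rightarrow> int" where
  "raise l I = (\<lambda>v. l v + (if v \<in> I then 1 else 0))"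

definition max_weight :: "(('v \<Rightarrow> int) \<Rightarrow> int) \<Rightarrow> 'v cube \<Rightarrow> int" where
  "max_weight X = (\<lambda>(l, I). Max ((\<lambda>I'. X (raise l I')) ` Pow I))"

text \<open>Translates moving one bound of a box by 1 into discarding the layer on that
  bound.\<close>

lemma all_upd_le_iff:
  fixes f g :: "'v \<Rightarrow> int"
  shows "(\<forall>u. (f(v := f v + 1)) u \<le> g u) \<longleftrightarrow> (\<forall>u. f u \<le> g u) \<and> g v \<noteq> f v"
    and "(\<forall>u. g u \<le> (f(v := f v - 1)) u) \<longleftrightarrow> (\<forall>u. g u \<le> f u) \<and> g v \<noteq> f v"
proof -
  have "f v + 1 \<le> g v \<longleftrightarrow> f v \<le> g v \<and> g v \<noteq> f v" "g v \<le> f v - 1 \<longleftrightarrow> g v \<le> f v \<and> g v \<noteq> f v"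
    by auto
  then show "(\<forall>u. (f(v := f v + 1)) u \<le> g u) \<longleftrightarrow> (\<forall>u. f u \<le> g u) \<and> g v \<noteq> f v"
    "(\<forall>u. g u \<le> (f(v := f v - 1)) u) \<longleftrightarrow> (\<forall>u. g u \<le> f u) \<and> g v \<noteq> f v"
    by (metis fun_upd_apply)+
qed

lemma raise_insert: "v \<notin> I \<Longrightarrow> raise l (insert v I) = raise (l(v := l v + 1)) I"
  by (auto simp: raise_def)

lemma raise_upd: "v \<notin> I \<Longrightarrow> raise (l(v := l v + 1)) I = (raise l I)(v := raise l I v + 1)"
  by (auto simp: raise_def)

lemma max_weight_insert:
  assumes "finite I" "v \<notin> I"
  shows "max_weight X (l, insert v I) = max (max_weight X (l, I)) (max_weight X (l(v := l v + 1), I))"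
proof -
  have "(\<lambda>I'. X (raise l I')) ` insert v ` Pow I = (\<lambda>I'. X (raise (l(v := l v + 1)) I')) ` Pow I"
    unfolding image_image using assms(2)
    by (intro image_cong refl arg_cong[where f = X] raise_insert) auto
  then show ?thesis
    using assms(1) unfolding max_weight_def prod.case Pow_insert image_Un
    by (subst Max_Un) auto
qed

lemma max_weight_ge: "finite I \<Longrightarrow> I' \<subseteq> I \<Longrightarrow> X (raise l I') \<le> max_weight X (l, I)"
  by (auto simp: max_weight_def)

lemma max_weight_le: "finite I \<Longrightarrow> (\<And>I'. I' \<subseteq> I \<Longrightarrow> X (raise l I') \<le> n) \<Longrightarrow> max_weight X (l, I) \<le> n"
  unfolding max_weight_def by (auto intro!: Max.boundedI)

lemma weighted_cubes_max_weight:
  assumes "finite V"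
  shows "weighted_cubes V (max_weight X)"
proof
  fix l I and i :: "'a::linorder"
  assume "I \<subseteq> V" "i \<in> I"
  then have "finite (I - {i})" "insert i (I - {i}) = I"
    using assms finite_subset by auto
  then show "max_weight X (l, I - {i}) \<le> max_weight X (l, I)"
    "max_weight X (l(i := l i + 1), I - {i}) \<le> max_weight X (l, I)"
    using max_weight_insert[of "I - {i}" i X l] by auto
qed fact

text \<open>
  In the application \<open>X\<close> is \<open>\<chi>\<^sub>k\<close>, \<open>a\<close> the intersection matrix, \<open>B\<close> the set of bad vertices,
  \<open>c v = \<chi>\<^sub>k(E\<^sub>v)\<close> and \<open>p l v = (l, E\<^sub>v)\<close>. The assumption \<open>laufer\<close> is what remains of the
  rationality of the modified graph.
\<close>

locale lattice_weight =
  fixes V B :: "'v::linorder set" and a :: "'v \<Rightarrow> 'v \<Rightarrow> int" and c :: "'v \<Rightarrow> int"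
    and X :: "('v \<Rightarrow> int) \<Rightarrow> int" and p :: "('v \<Rightarrow> int) \<Rightarrow> 'v \<Rightarrow> int"
  defines "p \<equiv> \<lambda>l v. \<Sum>u\<in>V. l u * a u v"
  assumes finite_V: "finite V" and B_V: "B \<subseteq> V"
    and off_diagonal: "\<And>u v. u \<noteq> v \<Longrightarrow> 0 \<le> a u v"
    and X_step: "\<And>l v. v \<in> V \<Longrightarrow> X (l(v := l v + 1)) = X l + c v - p l v"
    and laufer: "\<And>Y. \<lbrakk>\<forall>v\<in>V. 0 \<le> Y v; \<exists>v\<in>V. 0 < Y v; \<forall>v\<in>B. Y v \<le> 1\<rbrakk>
        \<Longrightarrow> \<exists>v\<in>V. 0 < Y v \<and> p Y v \<le> a v v + 1"
begin

abbreviation W :: "'v cube \<Rightarrow> int" where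
  "W \<equiv> max_weight X"

sublocale weighted_cubes V W
  by (intro weighted_cubes_max_weight finite_V)

text \<open>Off-diagonal entries are nonnegative, but the diagonal one carries no sign assumption;
  hence the agreement at \<open>v\<close>.\<close>

lemma p_mono:
  assumes "\<And>u. u \<in> V \<Longrightarrow> l u \<le> l' u" and "l v = l' v"
  shows "p l v \<le> p l' v"
  unfolding p_def
proof (rule sum_mono)
  fix u assume "u \<in> V"
  then show "l u * a u v \<le> l' u * a u v"
    using assms off_diagonal[of u v] by (cases "u = v") (auto intro: mult_right_mono)
qed

lemma p_upd: "v \<in> V \<Longrightarrow> p (l(v := l v + x)) u = p l u + x * a v u"
  using finite_V by (simp add: p_def sum.remove[of _ v] distrib_right)

lemma p_add: "p (\<lambda>v. l v + l' v) u = p l u + p l' u"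
  by (simp add: p_def distrib_right sum.distrib)

lemma p_diff: "p (\<lambda>v. l v - l' v) u = p l u - p l' u"
  by (simp add: p_def left_diff_distrib sum_subtractf)

text \<open>The lowest corner is the worst case: the other vertices of \<open>(l, I)\<close> have
  the same coordinate at \<open>v\<close> and larger ones elsewhere. So stepping in direction
  \<open>v\<close> raises \<open>X\<close> at no vertex, and the front face carries the
  maximum.\<close>

lemma W_up:
  assumes "I \<subseteq> V" "v \<in> V" "v \<notin> I" "c v \<le> p l v"
  shows "W (l, insert v I) = W (l, I)"
proof -
  have fin: "finite I"
    using assms(1) finite_V finite_subset by auto
  have "W (l(v := l v + 1), I) \<le> W (l, I)"
  proof (rule max_weight_le[OF fin])
    fix I' assume "I' \<subseteq> I"
    then have "v \<notin> I'"
      using assms by auto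
    have "X (raise (l(v := l v + 1)) I') = X (raise l I') + c v - p (raise l I') v"
      using X_step[OF assms(2), of "raise l I'"] raise_upd[OF \<open>v \<notin> I'\<close>, of l] by simp
    also have "p l v \<le> p (raise l I') v"
      using \<open>v \<notin> I'\<close> by (intro p_mono) (auto simp: raise_def)
    then have "X (raise l I') + c v - p (raise l I') v \<le> X (raise l I')"
      using assms(4) by simp
    also have "\<dots> \<le> W (l, I)"
      using fin \<open>I' \<subseteq> I\<close> by (rule max_weight_ge)
    finally show "X (raise (l(v := l v + 1)) I') \<le> W (l, I)" .
  qed
  then show ?thesis
    using fin assms by (simp add: max_weight_insert)
qed

text \<open>Dually, the highest corner of the front face is the worst case, and the back face
  carries the maximum.\<close>

lemma W_down:
  assumes "I \<subseteq> V" "v \<in> V" "v \<notin> I" "p (raise l I) v \<le> c v"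
  shows "W (l, insert v I) = W (l(v := l v + 1), I)"
proof -
  have fin: "finite I"
    using assms(1) finite_V finite_subset by auto
  have "W (l, I) \<le> W (l(v := l v + 1), I)"
  proof (rule max_weight_le[OF fin])
    fix I' assume "I' \<subseteq> I"
    then have "v \<notin> I'"
      using assms by auto
    have "p (raise l I') v \<le> p (raise l I) v"
      using \<open>I' \<subseteq> I\<close> \<open>v \<notin> I'\<close> assms(3) by (intro p_mono) (auto simp: raise_def)
    then have "X (raise l I') \<le> X (raise l I') + c v - p (raise l I') v"
      using assms(4) by simp
    also have "\<dots> = X (raise (l(v := l v + 1)) I')"
      using X_step[OF assms(2), of "raise l I'"] raise_upd[OF \<open>v \<notin> I'\<close>, of l] by simp
    also have "\<dots> \<le> W (l(v := l v + 1), I)"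
      using fin \<open>I' \<subseteq> I\<close> by (rule max_weight_ge)
    finally show "X (raise l I') \<le> W (l(v := l v + 1), I)" .
  qed
  then show ?thesis
    using fin assms by (simp add: max_weight_insert)
qed

section \<open>Boxes over a bad position and the removal of their outer layers\<close>

definition skeleton :: "nat \<Rightarrow> 'v cube set" where
  "skeleton m = {(l, I). I \<subseteq> V \<and> card (I \<inter> B) < m}"

text \<open>Only the good directions of a cube must stay within the bounds; those in
  \<open>J\<close> may stick out by one. With \<open>lo = hi\<close> off the good vertices this is a
  box inside a single fibre.\<close>

definition box :: "'v set \<Rightarrow> ('v \<Rightarrow> int) \<Rightarrow> ('v \<Rightarrow> int) \<Rightarrow> 'v cube set" where
  "box J lo hi = {(l, I). I \<subseteq> V \<and> I \<inter> B = J \<and> (\<forall>v. lo v \<le> l v \<and> raise l (I - B) v \<le> hi v)}"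

lemma finite_B: "finite B"
  using B_V finite_V finite_subset by auto

lemma closed_skeleton: "closed_cubes (skeleton m)"
  unfolding closed_cubes_def
proof (intro ballI conjI allI impI)
  fix x d assume x: "x \<in> skeleton m" and "is_face d x"
  then obtain i where i: "snd d = snd x - {i}"
    by (auto simp: is_face_def)
  have "card (snd d \<inter> B) \<le> card (snd x \<inter> B)"
    unfolding i using finite_B by (intro card_mono) auto
  with x i show "d \<in> skeleton m"
    by (cases x; cases d) (auto simp: skeleton_def)
qed (auto simp: skeleton_def)

lemma face_cases:
  assumes "is_face d (l, I)" "I \<subseteq> V"
  obtains i where "i \<in> I" "i \<in> B" "d \<in> skeleton (card (I \<inter> B))"
  | i where "i \<in> I" "i \<in> V - B" "d = (l, I - {i}) \<or> d = (l(i := l i + 1), I - {i})" "(I - {i}) \<inter> B = I \<inter> B"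
proof -
  obtain i where i: "i \<in> I" and d: "d = (l, I - {i}) \<or> d = (l(i := l i + 1), I - {i})"
    using assms by (auto simp: is_face_def)
  show ?thesis
  proof (cases "i \<in> B")
    case True
    have "card ((I - {i}) \<inter> B) < card (I \<inter> B)"
      using i True finite_B by (intro psubset_card_mono) auto
    then show ?thesis
      using that(1)[OF i True] d assms(2) by (auto simp: skeleton_def)
  next
    case False
    then show ?thesis
      using that(2)[OF i] i d assms(2) by auto
  qed
qed

lemma closed_box: "closed_cubes (skeleton (card J) \<union> box J lo hi)"
  unfolding closed_cubes_def
proof (intro ballI conjI allI impI)
  fix x assume x: "x \<in> skeleton (card J) \<union> box J lo hi"
  then show "snd x \<subseteq> V"
    by (auto simp: skeleton_def box_def)
  fix d assume d: "is_face d x"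
  show "d \<in> skeleton (card J) \<union> box J lo hi"
  proof (cases "x \<in> skeleton (card J)")
    case True
    then show ?thesis
      using closed_cubesD(2)[OF closed_skeleton _ d] by blast
  next
    case False
    obtain l I where lI: "x = (l, I)" by (cases x)
    with False x have "(l, I) \<in> box J lo hi"
      by auto
    then have I: "I \<subseteq> V" "I \<inter> B = J" and b: "\<And>v. lo v \<le> l v" "\<And>v. raise l (I - B) v \<le> hi v"
      by (auto simp: box_def)
    from d[unfolded lI] I(1) show ?thesis
    proof (cases rule: face_cases)
      case (2 i)
      have "lo v \<le> (l(i := l i + 1)) v" "raise l (I - {i} - B) v \<le> hi v"
        "raise (l(i := l i + 1)) (I - {i} - B) v \<le> hi v" for v
        using b(1)[of v] b(2)[of v] 2(1,2)
        by (cases "v = i"; cases "v \<in> I"; cases "v \<in> B"; auto simp: raise_def)+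
      then have "(l, I - {i}) \<in> box J lo hi" "(l(i := l i + 1), I - {i}) \<in> box J lo hi"
        using I b(1) 2(4) unfolding box_def mem_Collect_eq prod.case by blast+
      then show ?thesis
        using 2(3) by blast
    qed (use I in auto)
  qed
qed

text \<open>In the layer \<open>l v = lo v\<close>, a cube not pointing in direction
  \<open>v\<close> is matched with its product by the edge in that direction. The other faces of the
  product either point in direction \<open>v\<close> or lie one level higher, so no second element
  of \<open>U\<close> occurs among them.\<close>

lemma box_up:
  assumes v: "v \<in> V - B" "lo v < hi v"
    and W: "\<And>l I. (l, I) \<in> box J lo hi \<Longrightarrow> l v = lo v \<Longrightarrow> v \<notin> I \<Longrightarrow> W (l, insert v I) = W (l, I)"
  shows "extends q (skeleton (card J) \<union> box J (lo(v := lo v + 1)) hi) (skeleton (card J) \<union> box J lo hi)"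
proof -
  let ?X = "skeleton (card J) \<union> box J (lo(v := lo v + 1)) hi"
  define U where "U = {(l, I). (l, I) \<in> box J lo hi \<and> l v = lo v \<and> v \<notin> I}"
  define \<sigma> :: "'v cube \<Rightarrow> 'v cube" where "\<sigma> = (\<lambda>(l, I). (l, insert v I))"
  have \<sigma>U: "\<sigma> ` U = {(l, I). (l, I) \<in> box J lo hi \<and> l v = lo v \<and> v \<in> I}"
  proof (intro equalityI subsetI)
    fix x assume "x \<in> \<sigma> ` U"
    then show "x \<in> {(l, I). (l, I) \<in> box J lo hi \<and> l v = lo v \<and> v \<in> I}"
      using v by (auto simp: \<sigma>_def U_def box_def raise_def split: if_splits)
  next
    fix x assume "x \<in> {(l, I). (l, I) \<in> box J lo hi \<and> l v = lo v \<and> v \<in> I}"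
    then obtain l I where x: "x = (l, I)" "(l, I) \<in> box J lo hi" "l v = lo v" "v \<in> I"
      by auto
    have "raise l (I - {v} - B) u \<le> raise l (I - B) u" for u
      by (auto simp: raise_def)
    then have "(l, I - {v}) \<in> U"
      using x v by (auto simp: U_def box_def intro: order_trans)
    moreover have "x = \<sigma> (l, I - {v})"
      using x by (auto simp: \<sigma>_def)
    ultimately show "x \<in> \<sigma> ` U"
      by blast
  qed
  have X: "box J (lo(v := lo v + 1)) hi = {(l, I). (l, I) \<in> box J lo hi \<and> l v \<noteq> lo v}"
    unfolding box_def all_conj_distrib all_upd_le_iff by auto
  have eq: "skeleton (card J) \<union> box J lo hi = ?X \<union> U \<union> \<sigma> ` U"
    unfolding \<sigma>U unfolding X U_def by auto
  show ?thesis
    unfolding eq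
  proof (rule extends_collapse)
    fix t assume t: "t \<in> U"
    then obtain l I where t': "t = (l, I)" "(l, I) \<in> box J lo hi" "l v = lo v" "v \<notin> I"
      by (auto simp: U_def)
    have I: "I \<subseteq> V" "I \<inter> B = J"
      using t' by (auto simp: box_def)
    show "is_face t (\<sigma> t)"
      using t' by (auto simp: \<sigma>_def is_face_def)
    show "snd (\<sigma> t) \<subseteq> V"
      using t' v I by (auto simp: \<sigma>_def)
    show "W t = W (\<sigma> t)"
      using t' W by (auto simp: \<sigma>_def)
    fix d assume d: "is_face d (\<sigma> t)" "d \<noteq> t"
    have "\<sigma> t \<in> skeleton (card J) \<union> box J lo hi"
      using imageI[OF t, of \<sigma>] unfolding eq by simp
    then have dmem: "d \<in> skeleton (card J) \<union> box J lo hi"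
      using closed_cubesD(2)[OF closed_box _ d(1)] by blast
    obtain i where i: "i \<in> insert v I" "d = (l, insert v I - {i}) \<or> d = (l(i := l i + 1), insert v I - {i})"
      using d(1) unfolding is_face_def t'(1) \<sigma>_def prod.case fst_conv snd_conv by blast
    have "d \<notin> U"
    proof
      assume "d \<in> U"
      then have "i = v" "fst d v = lo v"
        using i by (auto simp: U_def)
      then show False
        using i d(2) t' by auto
    qed
    then show "d \<in> ?X \<union> \<sigma> ` U"
      using dmem unfolding eq by simp
  next
    have "U \<inter> skeleton (card J) = {}"
      by (auto simp: U_def box_def skeleton_def)
    then show "U \<inter> ?X = {}"
      unfolding X by (auto simp: U_def)
    show "\<sigma> ` U \<inter> U = {}"
      unfolding \<sigma>U unfolding U_def by auto
  qed (rule closed_box)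
qed

text \<open>Here the cube in the top layer is the back face of its partner, so the partner starts
  one step lower.\<close>

lemma box_down:
  assumes v: "v \<in> V - B" "lo v < hi v"
    and W: "\<And>l I. (l, I) \<in> box J lo hi \<Longrightarrow> l v = hi v \<Longrightarrow> v \<notin> I \<Longrightarrow> W (l(v := l v - 1), insert v I) = W (l, I)"
  shows "extends q (skeleton (card J) \<union> box J lo (hi(v := hi v - 1))) (skeleton (card J) \<union> box J lo hi)"
proof -
  let ?X = "skeleton (card J) \<union> box J lo (hi(v := hi v - 1))"
  define U where "U = {(l, I). (l, I) \<in> box J lo hi \<and> l v = hi v \<and> v \<notin> I}"
  define \<sigma> :: "'v cube \<Rightarrow> 'v cube" where "\<sigma> = (\<lambda>(l, I). (l(v := l v - 1), insert v I))"
  have \<sigma>U: "\<sigma> ` U = {(l, I). (l, I) \<in> box J lo hi \<and> l v = hi v - 1 \<and> v \<in> I}"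
  proof (intro equalityI subsetI)
    fix x assume "x \<in> \<sigma> ` U"
    then show "x \<in> {(l, I). (l, I) \<in> box J lo hi \<and> l v = hi v - 1 \<and> v \<in> I}"
      using v by (auto simp: \<sigma>_def U_def box_def raise_def split: if_splits)
  next
    fix x assume "x \<in> {(l, I). (l, I) \<in> box J lo hi \<and> l v = hi v - 1 \<and> v \<in> I}"
    then obtain l I where x: "x = (l, I)" "(l, I) \<in> box J lo hi" "l v = hi v - 1" "v \<in> I"
      by auto
    have "lo u \<le> (l(v := l v + 1)) u" "raise (l(v := l v + 1)) (I - {v} - B) u \<le> hi u" for u
    proof -
      have "lo u \<le> l u" "raise l (I - B) u \<le> hi u"
        using x(2) by (auto simp: box_def)
      then show "lo u \<le> (l(v := l v + 1)) u" "raise (l(v := l v + 1)) (I - {v} - B) u \<le> hi u"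
        using x v by (auto simp: raise_def split: if_splits)
    qed
    then have "(l(v := l v + 1), I - {v}) \<in> U"
      using x v by (auto simp: U_def box_def)
    moreover have "x = \<sigma> (l(v := l v + 1), I - {v})"
      using x by (auto simp: \<sigma>_def)
    ultimately show "x \<in> \<sigma> ` U"
      by blast
  qed
  have X: "(l, I) \<in> box J lo (hi(v := hi v - 1)) \<longleftrightarrow> (l, I) \<in> box J lo hi \<and> raise l (I - B) v \<noteq> hi v" for l I
    unfolding box_def all_conj_distrib all_upd_le_iff by auto
  have rv: "raise l (I - B) v = hi v \<longleftrightarrow> l v = hi v \<and> v \<notin> I \<or> l v = hi v - 1 \<and> v \<in> I" if "(l, I) \<in> box J lo hi" for l I
    using that v by (auto simp: box_def raise_def)
  have eq: "skeleton (card J) \<union> box J lo hi = ?X \<union> U \<union> \<sigma> ` U"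
    unfolding \<sigma>U unfolding U_def using X rv by auto
  show ?thesis
    unfolding eq
  proof (rule extends_collapse)
    fix t assume t: "t \<in> U"
    then obtain l I where t': "t = (l, I)" "(l, I) \<in> box J lo hi" "l v = hi v" "v \<notin> I"
      by (auto simp: U_def)
    have I: "I \<subseteq> V" "I \<inter> B = J"
      using t' by (auto simp: box_def)
    show "is_face t (\<sigma> t)"
      using t' by (auto simp: \<sigma>_def is_face_def)
    show "snd (\<sigma> t) \<subseteq> V"
      using t' v I by (auto simp: \<sigma>_def)
    show "W t = W (\<sigma> t)"
      using t' W by (auto simp: \<sigma>_def)
    fix d assume d: "is_face d (\<sigma> t)" "d \<noteq> t"
    have "\<sigma> t \<in> skeleton (card J) \<union> box J lo hi"
      using imageI[OF t, of \<sigma>] unfolding eq by simp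
    then have dmem: "d \<in> skeleton (card J) \<union> box J lo hi"
      using closed_cubesD(2)[OF closed_box _ d(1)] by blast
    define l' where "l' = l(v := l v - 1)"
    obtain i where i: "i \<in> insert v I" "d = (l', insert v I - {i}) \<or> d = (l'(i := l' i + 1), insert v I - {i})"
      using d(1) unfolding is_face_def t'(1) \<sigma>_def prod.case fst_conv snd_conv l'_def[symmetric] by blast
    have "d \<notin> U"
    proof
      assume "d \<in> U"
      then have "i = v" "fst d v = hi v"
        using i by (auto simp: U_def)
      then show False
        using i d(2) t' by (auto simp: l'_def)
    qed
    then show "d \<in> ?X \<union> \<sigma> ` U"
      using dmem unfolding eq by simp
  next
    have "U \<inter> skeleton (card J) = {}"
      by (auto simp: U_def box_def skeleton_def)
    moreover have "U \<inter> box J lo (hi(v := hi v - 1)) = {}"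
      using X rv by (auto simp: U_def)
    ultimately show "U \<inter> ?X = {}"
      by auto
    show "\<sigma> ` U \<inter> U = {}"
      unfolding \<sigma>U unfolding U_def by auto
  qed (rule closed_box)
qed

lemma W_down_pred:
  assumes "I \<subseteq> V" "v \<in> V" "v \<notin> I" "p ((raise l I)(v := raise l I v - 1)) v \<le> c v"
  shows "W (l(v := l v - 1), insert v I) = W (l, I)"
proof -
  have "raise (l(v := l v - 1)) I = (raise l I)(v := raise l I v - 1)"
    using assms(3) by (auto simp: raise_def)
  then show ?thesis
    using W_down[of I v "l(v := l v - 1)"] assms by simp
qed

text \<open>The top corner of the shifted cube lies below that of the shifted box and agrees with it
  at \<open>v\<close>, so \<open>p_mono\<close> applies. Stepping back by \<open>E v\<close>
  subtracts \<open>a v v\<close>, which explains the bound \<open>c v + a v v\<close> at the top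
  corner.\<close>

lemma p_below_top:
  assumes lI: "(l, I) \<in> box J lo hi" and Je: "Je \<subseteq> B" and v: "v \<in> V"
    and eq: "raise (\<lambda>u. l u + e u) (I - B \<union> Je) v = raise (\<lambda>u. hi u + e u) Je v"
    and top: "p (raise (\<lambda>u. hi u + e u) Je) v \<le> c v + a v v"
  shows "p ((raise (\<lambda>u. l u + e u) (I - B \<union> Je))(v := raise (\<lambda>u. l u + e u) (I - B \<union> Je) v - 1)) v \<le> c v"
proof -
  have le: "raise l (I - B) u \<le> hi u" for u
    using lI by (simp add: box_def)
  have "raise (\<lambda>u. l u + e u) (I - B \<union> Je) u \<le> raise (\<lambda>u. hi u + e u) Je u" for u
    using le[of u] Je by (cases "u \<in> I"; cases "u \<in> B"; cases "u \<in> Je") (auto simp: raise_def)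
  then have "p (raise (\<lambda>u. l u + e u) (I - B \<union> Je)) v \<le> p (raise (\<lambda>u. hi u + e u) Je) v"
    using eq by (intro p_mono)
  moreover have "p ((raise (\<lambda>u. l u + e u) (I - B \<union> Je))(v := raise (\<lambda>u. l u + e u) (I - B \<union> Je) v - 1)) v
      = p (raise (\<lambda>u. l u + e u) (I - B \<union> Je)) v - a v v"
    using p_upd[OF v, of "raise (\<lambda>u. l u + e u) (I - B \<union> Je)" "- 1" v] by simp
  ultimately show ?thesis
    using top by simp
qed

lemma box_mono:
  assumes "\<And>u. lo u \<le> lo' u" "\<And>u. hi' u \<le> hi u"
  shows "box J lo' hi' \<subseteq> box J lo hi"
  using assms unfolding box_def by clarsimp (meson order_trans)

lemma box_insert_up:
  assumes "(l, I) \<in> box J lo hi" "v \<in> V - B" "v \<notin> I" "l v < hi v"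
  shows "(l, insert v I) \<in> box J lo hi"
proof -
  have "raise l (insert v I - B) u \<le> hi u" for u
    using assms by (cases "u = v") (auto simp: box_def raise_def)
  then show ?thesis
    using assms by (auto simp: box_def)
qed

lemma box_insert_down:
  assumes "(l, I) \<in> box J lo hi" "v \<in> V - B" "v \<notin> I" "lo v < l v"
  shows "(l(v := l v - 1), insert v I) \<in> box J lo hi"
proof -
  have "raise (l(v := l v - 1)) (insert v I - B) u \<le> hi u" "lo u \<le> (l(v := l v - 1)) u" for u
  proof -
    have *: "lo u \<le> l u" "raise l (I - B) u \<le> hi u"
      using assms(1) by (auto simp: box_def)
    then show "raise (l(v := l v - 1)) (insert v I - B) u \<le> hi u" "lo u \<le> (l(v := l v - 1)) u"
      using assms by (cases "u = v"; auto simp: raise_def)+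
  qed
  then show ?thesis
    using assms unfolding box_def mem_Collect_eq prod.case by blast
qed

text \<open>
  The data \<open>e\<close> and \<open>Je\<close> record the bad directions already disposed of: the directions in
  \<open>J - Je\<close> do not influence the weights in the box, where those that never decrease the weight
  have been added to the base point by \<open>e\<close>.
\<close>

lemma box_contract:
  assumes "J \<subseteq> B" "Je \<subseteq> B" and le: "\<And>v. lo v \<le> hi v" and eq: "\<And>v. v \<notin> V - B \<Longrightarrow> lo v = hi v"
    and inv: "\<And>l I. (l, I) \<in> box J lo hi \<Longrightarrow> W (l, I) = W (\<lambda>u. l u + e u, I - B \<union> Je)"
  shows "\<exists>c. (\<forall>v. lo v \<le> c v \<and> c v \<le> hi v) \<and>
    extends q (skeleton (card J) \<union> box J c c) (skeleton (card J) \<union> box J lo hi)"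
  using assms
proof (induction "nat (\<Sum>v\<in>V - B. hi v - lo v) + card Je" arbitrary: lo hi e Je rule: less_induct)
  case less
  note inv = less.prems(5)
  have fin: "finite (V - B)" "finite Je"
    using finite_V finite_B less.prems(2) finite_subset by auto
  let ?T = "raise (\<lambda>u. hi u + e u) Je"
  have box_lo: "lo u \<le> l u" and box_hi: "l u \<le> hi u" if "(l, I) \<in> box J lo hi" for l I u
  proof -
    have "lo u \<le> l u" "raise l (I - B) u \<le> hi u"
      using that by (auto simp: box_def)
    then show "lo u \<le> l u" "l u \<le> hi u"
      by (auto simp: raise_def split: if_splits)
  qed
  have box_V: "I - B \<union> Je \<subseteq> V" if "(l, I) \<in> box J lo hi" for l I
    using that less.prems(2) B_V by (auto simp: box_def)
  have box_ins: "(l, insert v I) \<in> box J lo hi"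
    if "(l, I) \<in> box J lo hi" "v \<in> V - B" "v \<notin> I" "l v < hi v" for l I v
    using that by (rule box_insert_up)
  consider (up) v where "v \<in> V - B" "lo v < hi v" "c v \<le> p (\<lambda>u. lo u + e u) v"
    | (down) v where "v \<in> V - B" "lo v < hi v" "p ?T v \<le> c v + a v v"
    | (drop) j where "j \<in> Je" "c j \<le> p (\<lambda>u. lo u + e u) j"
    | (inc) j where "j \<in> Je" "p ?T j \<le> c j + a j j"
    | (trivial) "lo = hi"
  proof (cases "lo = hi")
    case False
    then obtain w where w: "lo w \<noteq> hi w"
      by blast
    then have wV: "w \<in> V - B" "lo w < hi w"
      using less.prems(3)[of w] less.prems(4)[of w] by auto
    \<comment> \<open>Top corner minus bottom corner; the shift \<open>e\<close> cancels. On
      \<open>B\<close> the entries are 0 or 1, as \<open>laufer\<close> demands, because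
      \<open>lo = hi\<close> there.\<close>
    define Y where "Y u = hi u - lo u + (if u \<in> Je then 1 else 0)" for u
    have Y0: "0 \<le> Y v" for v
      using less.prems(3)[of v] by (simp add: Y_def)
    have "Y w > 0"
      using wV less.prems(2) by (auto simp: Y_def)
    moreover have "Y v \<le> 1" if "v \<in> B" for v
      using that less.prems(4)[of v] by (simp add: Y_def)
    ultimately obtain v where v: "v \<in> V" "0 < Y v" "p Y v \<le> a v v + 1"
      using laufer[of Y] Y0 wV by blast
    have "?T = (\<lambda>u. (lo u + e u) + Y u)"
      by (auto simp: Y_def raise_def)
    then have T: "p ?T v \<le> p (\<lambda>u. lo u + e u) v + a v v + 1"
      using v(3) by (simp add: p_add)
    show ?thesis
    proof (cases "v \<in> Je")
      case True
      with that(3,4) T show ?thesis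
        by force
    next
      case False
      then have "v \<in> V - B" "lo v < hi v"
        using v less.prems(4)[of v] by (auto simp: Y_def)
      with that(1,2) T show ?thesis
        by force
    qed
  qed (use that in blast)
  then show ?case
  proof cases
    case up
    let ?lo = "lo(v := lo v + 1)"
    have sub: "box J ?lo hi \<subseteq> box J lo hi"
      by (rule box_mono) auto
    have "(\<Sum>v\<in>V - B. hi v - ?lo v) < (\<Sum>v\<in>V - B. hi v - lo v)"
      using up fin by (intro sum_strict_mono_ex1) auto
    moreover have "0 \<le> (\<Sum>v\<in>V - B. hi v - ?lo v)"
      using up less.prems(3) by (intro sum_nonneg) auto
    ultimately have less_sum: "nat (\<Sum>v\<in>V - B. hi v - ?lo v) + card Je < nat (\<Sum>v\<in>V - B. hi v - lo v) + card Je"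
      by linarith
    have "\<exists>x. (\<forall>v. ?lo v \<le> x v \<and> x v \<le> hi v) \<and>
      extends q (skeleton (card J) \<union> box J x x) (skeleton (card J) \<union> box J ?lo hi)"
    proof (rule less.hyps[of hi ?lo Je e, OF less_sum])
      show "?lo u \<le> hi u" for u
        using up(2) less.prems(3)[of u] by simp
      show "?lo u = hi u" if "u \<notin> V - B" for u
        using less.prems(4)[OF that] that up(1) by auto
      show "W (l, I) = W (\<lambda>u. l u + e u, I - B \<union> Je)" if "(l, I) \<in> box J ?lo hi" for l I
        using that sub by (intro inv) blast
    qed (use less.prems in blast)+
    then obtain x where x: "\<And>v. ?lo v \<le> x v \<and> x v \<le> hi v"
      "extends q (skeleton (card J) \<union> box J x x) (skeleton (card J) \<union> box J ?lo hi)"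
      by blast
    have "extends q (skeleton (card J) \<union> box J ?lo hi) (skeleton (card J) \<union> box J lo hi)"
    proof (rule box_up[where lo = lo and hi = hi, OF up(1,2)])
      fix l I assume lI: "(l, I) \<in> box J lo hi" "l v = lo v" "v \<notin> I"
      have "c v \<le> p (\<lambda>u. l u + e u) v"
        using p_mono[of "\<lambda>u. lo u + e u" "\<lambda>u. l u + e u" v] up(3) lI box_lo[OF lI(1)] by simp
      then have "W (\<lambda>u. l u + e u, insert v (I - B \<union> Je)) = W (\<lambda>u. l u + e u, I - B \<union> Je)"
        using up(1) less.prems(2) lI by (intro W_up box_V[OF lI(1)]) auto
      moreover have "insert v I - B \<union> Je = insert v (I - B \<union> Je)"
        using up(1) by auto
      ultimately show "W (l, insert v I) = W (l, I)"
        using inv[OF lI(1)] inv[OF box_ins[OF lI(1) up(1) lI(3)]] up(2) lI(2) by simp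
    qed
    then have "extends q (skeleton (card J) \<union> box J x x) (skeleton (card J) \<union> box J lo hi)"
      using x(1) by (intro extends_trans[OF x(2)] Un_mono box_mono) auto
    moreover have "lo u \<le> x u \<and> x u \<le> hi u" for u
      using x(1)[of u] by (cases "u = v") auto
    ultimately show ?thesis
      by blast
  next
    case down
    let ?hi = "hi(v := hi v - 1)"
    have sub: "box J lo ?hi \<subseteq> box J lo hi"
      by (rule box_mono) auto
    have "(\<Sum>v\<in>V - B. ?hi v - lo v) < (\<Sum>v\<in>V - B. hi v - lo v)"
      using down fin by (intro sum_strict_mono_ex1) auto
    moreover have "0 \<le> (\<Sum>v\<in>V - B. ?hi v - lo v)"
      using down less.prems(3) by (intro sum_nonneg) auto
    ultimately have less_sum: "nat (\<Sum>v\<in>V - B. ?hi v - lo v) + card Je < nat (\<Sum>v\<in>V - B. hi v - lo v) + card Je"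
      by linarith
    have "\<exists>x. (\<forall>v. lo v \<le> x v \<and> x v \<le> ?hi v) \<and>
      extends q (skeleton (card J) \<union> box J x x) (skeleton (card J) \<union> box J lo ?hi)"
    proof (rule less.hyps[of ?hi lo Je e, OF less_sum])
      show "lo u \<le> ?hi u" for u
        using down(2) less.prems(3)[of u] by simp
      show "lo u = ?hi u" if "u \<notin> V - B" for u
        using less.prems(4)[OF that] that down(1) by auto
      show "W (l, I) = W (\<lambda>u. l u + e u, I - B \<union> Je)" if "(l, I) \<in> box J lo ?hi" for l I
        using that sub by (intro inv) blast
    qed (use less.prems in blast)+
    then obtain x where x: "\<And>v. lo v \<le> x v \<and> x v \<le> ?hi v"
      "extends q (skeleton (card J) \<union> box J x x) (skeleton (card J) \<union> box J lo ?hi)"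
      by blast
    have "extends q (skeleton (card J) \<union> box J lo ?hi) (skeleton (card J) \<union> box J lo hi)"
    proof (rule box_down[where lo = lo and hi = hi, OF down(1,2)])
      fix l I assume lI: "(l, I) \<in> box J lo hi" "l v = hi v" "v \<notin> I"
      have vn: "v \<notin> I - B \<union> Je"
        using down(1) less.prems(2) lI by auto
      have "W ((\<lambda>u. l u + e u)(v := l v + e v - 1), insert v (I - B \<union> Je)) = W (\<lambda>u. l u + e u, I - B \<union> Je)"
        using vn down lI less.prems(2)
        by (intro W_down_pred box_V[OF lI(1)] p_below_top[OF lI(1)]) (auto simp: raise_def)
      moreover have "(\<lambda>u. l u + e u)(v := l v + e v - 1) = (\<lambda>u. (l(v := l v - 1)) u + e u)"
        by auto
      moreover have "insert v I - B \<union> Je = insert v (I - B \<union> Je)"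
        using down(1) by auto
      moreover have "(l(v := l v - 1), insert v I) \<in> box J lo hi"
        using lI down by (intro box_insert_down) auto
      ultimately show "W (l(v := l v - 1), insert v I) = W (l, I)"
        using inv[OF lI(1)] inv by simp
    qed
    then have "extends q (skeleton (card J) \<union> box J x x) (skeleton (card J) \<union> box J lo hi)"
      using x(1) by (intro extends_trans[OF x(2)] Un_mono box_mono) auto
    moreover have "lo u \<le> x u \<and> x u \<le> hi u" for u
      using x(1)[of u] by (cases "u = v") auto
    ultimately show ?thesis
      by blast
  next
    case drop
    have "card (Je - {j}) < card Je"
      using drop fin by (intro psubset_card_mono) auto
    \<comment> \<open>A step in direction \<open>j\<close> never raises \<open>X\<close> on these
      cubes, so the front face already has the full weight and \<open>j\<close> can be
      erased.\<close>
    moreover have "W (l, I) = W (\<lambda>u. l u + e u, I - B \<union> (Je - {j}))" if lI: "(l, I) \<in> box J lo hi" for l I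
    proof -
      have jB: "j \<in> B"
        using drop less.prems(2) by auto
      have "l j = lo j"
        using box_lo[OF lI, of j] box_hi[OF lI, of j] less.prems(4)[of j] jB by simp
      then have "c j \<le> p (\<lambda>u. l u + e u) j"
        using p_mono[of "\<lambda>u. lo u + e u" "\<lambda>u. l u + e u" j] drop box_lo[OF lI] by simp
      then have "W (\<lambda>u. l u + e u, insert j (I - B \<union> (Je - {j}))) = W (\<lambda>u. l u + e u, I - B \<union> (Je - {j}))"
        using jB B_V box_V[OF lI] by (intro W_up) auto
      moreover have "insert j (I - B \<union> (Je - {j})) = I - B \<union> Je"
        using drop by auto
      ultimately show ?thesis
        using inv[OF lI] by simp
    qed
    ultimately show ?thesis
      using less.prems by (intro less.hyps[of hi lo "Je - {j}" e]) auto
  next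
    case inc
    have "card (Je - {j}) < card Je"
      using inc fin by (intro psubset_card_mono) auto
    \<comment> \<open>Now a step in direction \<open>j\<close> never lowers \<open>X\<close>, so the
      back face has the full weight; passing to it moves the base point by \<open>E j\<close>, which
      \<open>e\<close> records.\<close>
    moreover have "W (l, I) = W (\<lambda>u. l u + (e(j := e j + 1)) u, I - B \<union> (Je - {j}))" if lI: "(l, I) \<in> box J lo hi" for l I
    proof -
      have jB: "j \<in> B"
        using inc less.prems(2) by auto
      have lj: "l j = hi j"
        using box_lo[OF lI, of j] box_hi[OF lI, of j] less.prems(4)[of j] jB by simp
      have jn: "j \<notin> I - B \<union> (Je - {j})"
        using jB by auto
      have "raise (\<lambda>u. l u + e u) (I - B \<union> (Je - {j}))
        = (raise (\<lambda>u. l u + e u) (I - B \<union> Je))(j := raise (\<lambda>u. l u + e u) (I - B \<union> Je) j - 1)"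
        using inc jB by (auto simp: raise_def)
      then have "p (raise (\<lambda>u. l u + e u) (I - B \<union> (Je - {j}))) j \<le> c j"
        using p_below_top[OF lI less.prems(2), of j e] inc jB B_V lj by (auto simp: raise_def)
      then have "W (\<lambda>u. l u + e u, insert j (I - B \<union> (Je - {j}))) =
          W ((\<lambda>u. l u + e u)(j := l j + e j + 1), I - B \<union> (Je - {j}))"
        using jB B_V box_V[OF lI] jn by (intro W_down) auto
      moreover have "(\<lambda>u. l u + e u)(j := l j + e j + 1) = (\<lambda>u. l u + (e(j := e j + 1)) u)"
        by auto
      moreover have "insert j (I - B \<union> (Je - {j})) = I - B \<union> Je"
        using inc by auto
      ultimately show ?thesis
        using inv[OF lI] by simp
    qed
    ultimately show ?thesis
      using less.prems inc by (intro less.hyps[of hi lo "Je - {j}" "e(j := e j + 1)"]) auto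
  next
    case trivial
    then show ?thesis
      using extends_refl by blast
  qed
qed

end

section \<open>Vanishing for weights of lattice type\<close>

lemma int_primitive:
  fixes d :: "int \<Rightarrow> 'b::ab_group_add"
  shows "\<exists>g. \<forall>t. g (t + 1) - g t = d t"
proof (intro exI allI)
  fix t :: int
  \<comment> \<open>Summation from 0 in either direction; the interval on the other side is
    empty.\<close>
  define g where "g t = sum d {0..<t} - sum d {t..<0}" for t
  show "g (t + 1) - g t = d t"
  proof (cases "0 \<le> t")
    case True
    then have "{0..<t + 1} = insert t {0..<t}"
      by auto
    then show ?thesis
      using True by (simp add: g_def)
  next
    case False
    then have "{t..<0} = insert t {t + 1..<0}"
      by auto
    then show ?thesis
      using False by (simp add: g_def)
  qed
qed

locale negative_lattice_weight = lattice_weight +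
  fixes Z m
  assumes negative: "\<And>d. (\<forall>v. v \<notin> V - B \<longrightarrow> d v = 0) \<Longrightarrow> d \<noteq> (\<lambda>v. 0) \<Longrightarrow> (\<Sum>v\<in>V. d v * p d v) < 0"
    and Z: \<comment> \<open>the boxes \<open>[- n Z, n Z]\<close> exhaust the fibres\<close> "\<And>v. v \<in> V - B \<Longrightarrow> 0 < Z v" "\<And>v. v \<in> V - B \<Longrightarrow> p Z v < 0"
      "\<And>v. v \<notin> V - B \<Longrightarrow> Z v = 0"
    and lower_bound: "\<And>l. m \<le> X l"
begin

section \<open>Exhaustion of a fibre by boxes\<close>

lemma shrink_lo:
  assumes lo: "\<And>v. v \<in> V - B \<Longrightarrow> c v - 1 \<le> p lo v"
    and le: "\<And>v. lo v \<le> hi v" "\<And>v. b v \<le> lo v" and eq: "\<And>v. v \<notin> V - B \<Longrightarrow> b v = lo v"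
  shows "extends q (skeleton (card J) \<union> box J lo hi) (skeleton (card J) \<union> box J b hi)"
  using le(2) eq
proof (induction "nat (\<Sum>v\<in>V - B. lo v - b v)" arbitrary: b rule: less_induct)
  case less
  have fin: "finite (V - B)"
    using finite_V by auto
  show ?case
  proof (cases "b = lo")
    case False
    define d where "d v = lo v - b v" for v
    have d: "0 \<le> d v" "v \<notin> V - B \<Longrightarrow> d v = 0" for v
      using less.prems(1)[of v] less.prems(2)[of v] by (auto simp: d_def)
    have "d \<noteq> (\<lambda>v. 0)"
      using False by (metis d_def eq_iff_diff_eq_0 ext)
    then have neg: "(\<Sum>v\<in>V. d v * p d v) < 0"
      using d(2) by (intro negative) auto
    \<comment> \<open>Since \<open>d\<close> has negative square, some \<open>v\<close> has
      \<open>d v > 0\<close> and \<open>p d v < 0\<close>. Then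
      \<open>p b v \<ge> p lo v + 1 \<ge> c v\<close>, which makes up for the 1 in the assumption on
      \<open>lo\<close>; the layer of \<open>b\<close> in direction \<open>v\<close> can be peeled
      off.\<close>
    have "\<exists>v\<in>V - B. 0 < d v \<and> c v \<le> p b v"
    proof (rule ccontr)
      assume contr: "\<not> ?thesis"
      have "0 \<le> d v * p d v" if "v \<in> V" for v
      proof (cases "d v = 0")
        case False
        then have "v \<in> V - B" "0 < d v"
          using d[of v] by auto
        then have "p b v \<le> c v - 1"
          using contr by force
        moreover have "p d v = p lo v - p b v"
          unfolding d_def by (rule p_diff)
        ultimately have "0 \<le> p d v"
          using lo[OF \<open>v \<in> V - B\<close>] by simp
        then show ?thesis
          using d(1)[of v] by simp
      qed simp
      then have "0 \<le> (\<Sum>v\<in>V. d v * p d v)"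
        by (intro sum_nonneg)
      with neg show False
        by simp
    qed
    then obtain v where v: "v \<in> V - B" "b v < lo v" "c v \<le> p b v"
      by (auto simp: d_def)
    let ?b = "b(v := b v + 1)"
    have "(\<Sum>v\<in>V - B. lo v - ?b v) < (\<Sum>v\<in>V - B. lo v - b v)"
      using v fin by (intro sum_strict_mono_ex1) auto
    moreover have "0 \<le> (\<Sum>v\<in>V - B. lo v - ?b v)"
      using v less.prems(1) by (intro sum_nonneg) auto
    ultimately have 1: "extends q (skeleton (card J) \<union> box J lo hi) (skeleton (card J) \<union> box J ?b hi)"
      using less.prems v by (intro less.hyps) auto
    have 2: "extends q (skeleton (card J) \<union> box J ?b hi) (skeleton (card J) \<union> box J b hi)"
    proof (rule box_up[where lo = b])
      show "v \<in> V - B" "b v < hi v"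
        using v le(1)[of v] by auto
      fix l I assume lI: "(l, I) \<in> box J b hi" "l v = b v" "v \<notin> I"
      then have "c v \<le> p l v"
        using v(3) p_mono[of b l v] by (auto simp: box_def)
      then show "W (l, insert v I) = W (l, I)"
        using v lI by (intro W_up) (auto simp: box_def)
    qed
    have "?b u \<le> lo u" for u
      using less.prems(1)[of u] v by auto
    with 1 2 show ?thesis
      by (intro extends_trans[OF 1 2] Un_mono box_mono) auto
  qed (use extends_refl in simp)
qed

lemma shrink_hi:
  assumes J: "J \<subseteq> B" and hi: "\<And>v. v \<in> V - B \<Longrightarrow> p (raise hi J) v \<le> c v + a v v"
    and le: "\<And>v. lo v \<le> hi v" "\<And>v. hi v \<le> b v" and eq: "\<And>v. v \<notin> V - B \<Longrightarrow> hi v = b v"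
  shows "extends q (skeleton (card J) \<union> box J lo hi) (skeleton (card J) \<union> box J lo b)"
  using le(2) eq
proof (induction "nat (\<Sum>v\<in>V - B. b v - hi v)" arbitrary: b rule: less_induct)
  case less
  have fin: "finite (V - B)"
    using finite_V by auto
  show ?case
  proof (cases "b = hi")
    case False
    define d where "d v = b v - hi v" for v
    have d: "0 \<le> d v" "v \<notin> V - B \<Longrightarrow> d v = 0" for v
      using less.prems(1)[of v] less.prems(2)[of v] by (auto simp: d_def)
    have "d \<noteq> (\<lambda>v. 0)"
      using False by (metis d_def eq_iff_diff_eq_0 ext)
    then have neg: "(\<Sum>v\<in>V. d v * p d v) < 0"
      using d(2) by (intro negative) auto
    \<comment> \<open>The top corner is raised by \<open>J\<close> because the cubes extend in these
      directions; the raise cancels in \<open>d\<close>, so the argument for the lower corner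
      carries over.\<close>
    have "\<exists>v\<in>V - B. 0 < d v \<and> p (raise b J) v \<le> c v + a v v"
    proof (rule ccontr)
      assume contr: "\<not> ?thesis"
      have "0 \<le> d v * p d v" if "v \<in> V" for v
      proof (cases "d v = 0")
        case False
        then have "v \<in> V - B" "0 < d v"
          using d[of v] by auto
        then have "c v + a v v < p (raise b J) v"
          using contr by force
        moreover have "d = (\<lambda>v. raise b J v - raise hi J v)"
          by (auto simp: d_def raise_def)
        then have "p d v = p (raise b J) v - p (raise hi J) v"
          by (simp only: p_diff)
        ultimately have "0 \<le> p d v"
          using hi[OF \<open>v \<in> V - B\<close>] by simp
        then show ?thesis
          using d(1)[of v] by simp
      qed simp
      then have "0 \<le> (\<Sum>v\<in>V. d v * p d v)"
        by (intro sum_nonneg)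
      with neg show False
        by simp
    qed
    then obtain v where v: "v \<in> V - B" "hi v < b v" "p (raise b J) v \<le> c v + a v v"
      by (auto simp: d_def)
    let ?b = "b(v := b v - 1)"
    have "(\<Sum>v\<in>V - B. ?b v - hi v) < (\<Sum>v\<in>V - B. b v - hi v)"
      using v fin by (intro sum_strict_mono_ex1) auto
    moreover have "0 \<le> (\<Sum>v\<in>V - B. ?b v - hi v)"
      using v less.prems(1) by (intro sum_nonneg) auto
    ultimately have 1: "extends q (skeleton (card J) \<union> box J lo hi) (skeleton (card J) \<union> box J lo ?b)"
      using less.prems v by (intro less.hyps) auto
    have 2: "extends q (skeleton (card J) \<union> box J lo ?b) (skeleton (card J) \<union> box J lo b)"
    proof (rule box_down[where hi = b])
      show "v \<in> V - B" "lo v < b v"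
        using v le(1)[of v] by auto
      fix l I assume lI: "(l, I) \<in> box J lo b" "l v = b v" "v \<notin> I"
      have I: "I - B \<union> J = I" "I \<subseteq> V"
        using lI by (auto simp: box_def)
      have "v \<notin> J"
        using v(1) J by auto
      then have "p ((raise l I)(v := raise l I v - 1)) v \<le> c v"
        using p_below_top[OF lI(1) J, of v "\<lambda>u. 0"] v lI unfolding I by (auto simp: raise_def)
      then show "W (l(v := l v - 1), insert v I) = W (l, I)"
        using v lI I by (intro W_down_pred) auto
    qed
    have "hi u \<le> ?b u" for u
      using less.prems(1)[of u] v by auto
    with 1 2 show ?thesis
      by (intro extends_trans[OF 1 2] Un_mono box_mono) auto
  qed (use extends_refl in simp)
qed

text \<open>\<open>i\<close> pins the bad coordinates and, base points being arbitrary, also those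
  outside \<open>V\<close>; its values at good vertices are ignored.\<close>

definition fiber :: "'a set \<Rightarrow> ('a \<Rightarrow> int) \<Rightarrow> 'a cube set" where
  "fiber J i = {(l, I). I \<subseteq> V \<and> I \<inter> B = J \<and> (\<forall>v. v \<notin> V - B \<longrightarrow> l v = i v)}"

lemma box_point: "J \<subseteq> B \<Longrightarrow> box J x x = {(x, J)}"
proof -
  assume J: "J \<subseteq> B"
  have "(l, I) = (x, J)" if "(l, I) \<in> box J x x" for l I
  proof -
    have *: "x v \<le> l v" "raise l (I - B) v \<le> x v" for v
      using that by (auto simp: box_def)
    have "I - B = {}"
    proof (rule ccontr)
      assume "I - B \<noteq> {}"
      then obtain v where "v \<in> I - B"
        by auto
      then show False
        using *[of v] by (auto simp: raise_def)
    qed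
    moreover have "l v = x v" for v
      using *[of v] by (auto simp: raise_def split: if_splits)
    moreover have "I \<inter> B = J"
      using that by (simp add: box_def)
    ultimately show ?thesis
      by auto
  qed
  moreover have "(x, J) \<in> box J x x"
    using J B_V by (auto simp: box_def raise_def)
  ultimately show ?thesis
    by auto
qed

lemma fiber_contract:
  assumes J: "J \<subseteq> B"
  shows "\<exists>x. (\<forall>v. v \<notin> V - B \<longrightarrow> x v = i v) \<and>
    extends q (skeleton (card J) \<union> {(x, J)}) (skeleton (card J) \<union> fiber J i)"
proof -
  define i' where "i' v = (if v \<in> V - B then 0 else i v)" for v
  define lo where "lo n v = i' v + - int n * Z v" for n v
  define hi where "hi n v = i' v + int n * Z v" for n v
  \<comment> \<open>The amounts by which the two corners may violate the shrinking conditions for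
    \<open>n = 0\<close>. As \<open>p Z v \<le> - 1\<close> at good vertices, moving the corners by
    \<open>n Z\<close> repairs a violation of size up to \<open>n\<close>.\<close>
  define g where "g v = nat \<bar>c v - 1 - p i' v\<bar> + nat \<bar>p (raise i' J) v - c v - a v v\<bar>" for v
  define n0 where "n0 = (\<Sum>v\<in>V. g v)"
  have n0: "g v \<le> n0" if "v \<in> V" for v
    unfolding n0_def using that finite_V by (intro member_le_sum) auto
  have p_scale: "p (\<lambda>u. x * Z u) v = x * p Z v" for x v
    unfolding p_def by (simp add: sum_distrib_left mult.assoc)
  have lo_ok: "c v - 1 \<le> p (lo n) v" if "v \<in> V - B" "n0 \<le> n" for v n
  proof -
    have "int n * 1 \<le> int n * - p Z v"
      using Z(2)[OF that(1)] by (intro mult_left_mono) auto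
    moreover have "c v - 1 - p i' v \<le> int n"
      using n0[of v] that unfolding g_def by auto
    moreover have "p (lo n) v = p i' v + - int n * p Z v"
      unfolding lo_def p_add p_scale ..
    ultimately show ?thesis
      by simp
  qed
  have hi_ok: "p (raise (hi n) J) v \<le> c v + a v v" if "v \<in> V - B" "n0 \<le> n" for v n
  proof -
    have "int n * p Z v \<le> int n * - 1"
      using Z(2)[OF that(1)] by (intro mult_left_mono) auto
    moreover have "p (raise i' J) v - c v - a v v \<le> int n"
      using n0[of v] that unfolding g_def by auto
    moreover have "raise (hi n) J = (\<lambda>u. raise i' J u + int n * Z u)"
      by (auto simp: hi_def raise_def)
    then have "p (raise (hi n) J) v = p (raise i' J) v + int n * p Z v"
      by (simp only: p_add p_scale)
    ultimately show ?thesis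
      by simp
  qed
  have Z0: "0 \<le> Z v" for v
    using Z(1,3)[of v] by (cases "v \<in> V - B") auto
  have off: "lo n v = i v" "hi n v = i v" if "v \<notin> V - B" for v n
    using that Z(3)[of v] by (auto simp: lo_def hi_def i'_def)
  have lo_hi: "lo n v \<le> hi k v" for n k v
  proof -
    have "0 \<le> int n * Z v" "0 \<le> int k * Z v"
      using Z0[of v] by simp_all
    then show ?thesis
      unfolding lo_def hi_def by linarith
  qed
  have lo_Suc: "lo (Suc n) v \<le> lo n v" and hi_Suc: "hi n v \<le> hi (Suc n) v" for n v
    using Z0[of v] by (auto simp: lo_def hi_def algebra_simps)
  define K where "K n = skeleton (card J) \<union> box J (lo (n0 + n)) (hi (n0 + n))" for n
  have "extends q (K n) (K (Suc n))" for n
  proof -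
    have "extends q (K n) (skeleton (card J) \<union> box J (lo (n0 + n)) (hi (n0 + Suc n)))"
      unfolding K_def using hi_ok[of _ "n0 + n"] lo_hi hi_Suc off
      by (intro shrink_hi J) (simp_all add: lo_hi)
    moreover have "extends q (skeleton (card J) \<union> box J (lo (n0 + n)) (hi (n0 + Suc n))) (K (Suc n))"
      unfolding K_def using lo_ok[of _ "n0 + n"] lo_hi lo_Suc off
      by (intro shrink_lo) (simp_all add: lo_hi)
    moreover have "K n \<subseteq> skeleton (card J) \<union> box J (lo (n0 + n)) (hi (n0 + Suc n))"
      unfolding K_def using hi_Suc by (intro Un_mono box_mono) auto
    ultimately show ?thesis
      using extends_trans by blast
  qed
  moreover have "closed_cubes (K n)" for n
    unfolding K_def by (rule closed_box)
  moreover have "K n \<subseteq> K (Suc n)" for n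
    unfolding K_def using hi_Suc lo_Suc by (intro Un_mono box_mono) auto
  ultimately have ext: "extends q (K 0) (\<Union>n. K n)"
    by (rule extends_chain)
  have "(\<Union>n. K n) = skeleton (card J) \<union> fiber J i"
  proof -
    have "(l, I) \<in> box J (lo n) (hi n) \<Longrightarrow> (l, I) \<in> fiber J i" for l I n
    proof -
      assume lI: "(l, I) \<in> box J (lo n) (hi n)"
      have "l v = i v" if "v \<notin> V - B" for v
      proof -
        have "lo n v \<le> l v" "raise l (I - B) v \<le> hi n v"
          using lI by (auto simp: box_def)
        then show ?thesis
          using off[OF that, of n] by (auto simp: raise_def split: if_splits)
      qed
      then show ?thesis
        using lI by (auto simp: box_def fiber_def)
    qed
    moreover have "\<exists>n. (l, I) \<in> box J (lo (n0 + n)) (hi (n0 + n))" if lI: "(l, I) \<in> fiber J i" for l I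
    proof -
      \<comment> \<open>The additional 1 leaves room for the raised corner of the cube.\<close>
      define k where "k = (\<Sum>v\<in>V. nat \<bar>l v\<bar> + 1)"
      have k: "\<bar>l v\<bar> + 1 \<le> int (n0 + k) * Z v" if "v \<in> V - B" for v
      proof -
        have "nat \<bar>l v\<bar> + 1 \<le> k"
          unfolding k_def using that finite_V by (intro member_le_sum) auto
        then have "\<bar>l v\<bar> + 1 \<le> int (n0 + k)"
          by linarith
        also have "int (n0 + k) * 1 \<le> int (n0 + k) * Z v"
          using Z(1)[OF that] by (intro mult_left_mono) auto
        finally show ?thesis
          by simp
      qed
      have "lo (n0 + k) v \<le> l v \<and> raise l (I - B) v \<le> hi (n0 + k) v" for v
      proof (cases "v \<in> V - B")
        case True
        then have "i' v = 0" "raise l (I - B) v \<le> l v + 1"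
          by (auto simp: i'_def raise_def)
        then show ?thesis
          using k[OF True] unfolding lo_def hi_def by (auto simp: abs_le_iff algebra_simps)
      next
        case False
        then have "v \<notin> I - B" "l v = i v"
          using lI by (auto simp: fiber_def)
        then show ?thesis
          using off[OF False] by (simp add: raise_def)
      qed
      then show ?thesis
        using lI by (auto simp: box_def fiber_def)
    qed
    ultimately show ?thesis
      unfolding K_def by auto
  qed
  with ext have ext: "extends q (K 0) (skeleton (card J) \<union> fiber J i)"
    by simp
  \<comment> \<open>The contraction starts without a shift and with every direction of
    \<open>J\<close> still influencing the weights.\<close>
  have "\<exists>x. (\<forall>v. lo n0 v \<le> x v \<and> x v \<le> hi n0 v) \<and>
    extends q (skeleton (card J) \<union> box J x x) (skeleton (card J) \<union> box J (lo n0) (hi n0))"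
  proof (rule box_contract[where e = "\<lambda>_. 0", OF J J])
    show "W (l, I) = W (\<lambda>u. l u + 0, I - B \<union> J)" if "(l, I) \<in> box J (lo n0) (hi n0)" for l I
    proof -
      have "I - B \<union> J = I"
        using that by (auto simp: box_def)
      then show ?thesis
        by simp
    qed
  qed (use lo_hi off in auto)
  then obtain x where x: "\<And>v. lo n0 v \<le> x v \<and> x v \<le> hi n0 v"
    "extends q (skeleton (card J) \<union> {(x, J)}) (K 0)"
    unfolding box_point[OF J] K_def by auto
  have "(x, J) \<in> box J (lo n0) (hi n0)"
    using box_mono[of "lo n0" x x "hi n0" J] x(1) box_point[OF J, of x] by auto
  then have "extends q (skeleton (card J) \<union> {(x, J)}) (skeleton (card J) \<union> fiber J i)"
    by (intro extends_trans[OF x(2) ext]) (auto simp: K_def)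
  moreover have "x v = i v" if "v \<notin> V - B" for v
    using x(1)[of v] off[OF that, of n0] by simp
  ultimately show ?thesis
    by blast
qed

text \<open>What remains of each fibre is one cube of dimension \<open>r\<close>, where no equation
  of degree \<open>q\<close> is imposed; so a partial primitive on the skeleton serves there
  unchanged and then spreads over the fibre.\<close>

lemma extends_skeleton:
  assumes "r \<noteq> q"
  shows "extends q (skeleton r) (skeleton (Suc r))"
proof -
  \<comment> \<open>Setting \<open>i\<close> to 0 at good vertices lists every fibre exactly once,
    as disjointness requires.\<close>
  define S where "S = {(J, i). J \<subseteq> B \<and> card J = r \<and> (\<forall>v\<in>V - B. i v = (0::int))}"
  define F where "F = (\<lambda>(J, i). fiber J i)"
  have "extends q (skeleton r) (skeleton r \<union> (\<Union>s\<in>S. F s))"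
  proof (rule extends_family)
    fix s assume "s \<in> S"
    then obtain J i where s: "s = (J, i)" "J \<subseteq> B" "card J = r"
      by (auto simp: S_def)
    obtain x where "extends q (skeleton r \<union> {(x, J)}) (skeleton r \<union> fiber J i)"
      using fiber_contract[OF s(2), of i q] s(3) by blast
    moreover have "extends q (skeleton r) (skeleton r \<union> {(x, J)})"
      using assms s(3) by (auto simp: extends_def bounds_on_def)
    ultimately show "extends q (skeleton r) (skeleton r \<union> F s)"
      using extends_trans by (auto simp: F_def s(1))
    show "closed_cubes (skeleton r \<union> F s)"
      unfolding closed_cubes_def
    proof (intro ballI conjI allI impI)
      fix y d assume y: "y \<in> skeleton r \<union> F s"
      then show "snd y \<subseteq> V"
        by (auto simp: skeleton_def F_def s(1) fiber_def)
      assume d: "is_face d y"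
      show "d \<in> skeleton r \<union> F s"
      proof (cases "y \<in> skeleton r")
        case True
        then show ?thesis
          using closed_cubesD(2)[OF closed_skeleton _ d] by blast
      next
        case False
        obtain l I where lI: "y = (l, I)" by (cases y)
        with False y have I: "I \<subseteq> V" "I \<inter> B = J" "\<And>v. v \<notin> V - B \<Longrightarrow> l v = i v"
          by (auto simp: F_def s(1) fiber_def)
        from d[unfolded lI] I(1) show ?thesis
        proof (cases rule: face_cases)
          case (2 k)
          have "(l(k := l k + 1)) v = i v" if "v \<notin> V - B" for v
            using I(3)[OF that] 2(2) that by (cases "v = k") auto
          then have "(l, I - {k}) \<in> fiber J i" "(l(k := l k + 1), I - {k}) \<in> fiber J i"
            using I 2(4) unfolding fiber_def by blast+
          with 2(3) show ?thesis
            by (auto simp: F_def s(1))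
        qed (use I s in auto)
      qed
    qed
    show "F s \<inter> skeleton r = {}"
      using s by (auto simp: F_def fiber_def skeleton_def)
    fix s' assume s': "s' \<in> S" "s \<noteq> s'"
    then obtain J' i' where s'': "s' = (J', i')"
      by (cases s')
    show "F s \<inter> F s' = {}"
    proof (rule ccontr)
      assume "F s \<inter> F s' \<noteq> {}"
      then obtain l I where lI: "(l, I) \<in> fiber J i" "(l, I) \<in> fiber J' i'"
        by (auto simp: F_def s s'')
      then have "J = J'"
        by (auto simp: fiber_def)
      moreover have "i v = i' v" for v
        using lI \<open>s \<in> S\<close> s' by (cases "v \<in> V - B") (auto simp: S_def s(1) s'' fiber_def)
      ultimately show False
        using s'(2) by (auto simp: s(1) s'')
    qed
  qed (rule closed_skeleton)
  moreover have "skeleton r \<union> (\<Union>s\<in>S. F s) = skeleton (Suc r)"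
  proof -
    have "(l, I) \<in> (\<Union>s\<in>S. F s)" if "I \<subseteq> V" "card (I \<inter> B) = r" for l I
    proof -
      have "(I \<inter> B, \<lambda>v. if v \<in> V - B then 0 else l v) \<in> S"
        using that by (auto simp: S_def)
      moreover have "(l, I) \<in> F (I \<inter> B, \<lambda>v. if v \<in> V - B then 0 else l v)"
        using that by (auto simp: F_def fiber_def)
      ultimately show ?thesis
        by blast
    qed
    then show ?thesis
      by (auto simp: skeleton_def less_Suc_eq F_def S_def fiber_def)
  qed
  ultimately show ?thesis
    by simp
qed

lemma extends_skeletons:
  assumes "r \<le> q"
  shows "extends q {} (skeleton r)"
  using assms
proof (induction r)
  case 0
  have "skeleton 0 = {}"
    by (auto simp: skeleton_def)
  then show ?case
    by (simp add: extends_refl)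
next
  case (Suc r)
  then show ?case
    using extends_trans[OF Suc.IH extends_skeleton] by auto
qed

lemma bounds_skeleton:
  assumes "r \<le> q" "cocycle q \<phi>"
  shows "\<exists>\<psi>. bounds_on q (skeleton r) \<phi> \<psi>"
  using extends_skeletons[OF assms(1)] assms(2) by (auto simp: extends_def bounds_on_def)

lemma skeleton_Suc_card: "skeleton (Suc (card B)) = {(l, I). I \<subseteq> V}"
proof -
  have "card (I \<inter> B) < Suc (card B)" for I
    using card_mono[OF finite_B, of "I \<inter> B"] by auto
  then show ?thesis
    by (auto simp: skeleton_def)
qed

section \<open>Integration in the top degree\<close>

lemma W_lower_bound: "I \<subseteq> V \<Longrightarrow> m \<le> W (l, I)"
  using max_weight_ge[of I "{}" X l] lower_bound[of "raise l {}"] finite_V finite_subset[of I V] by auto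

text \<open>The factor \<open>U^(W - m)\<close> turns the weighted coboundary into the ordinary
  cubical one: all exponents add up to \<open>W (l, I) - m\<close>. The common lower bound
  \<open>m\<close> keeps them nonnegative.\<close>

lemma cobd_scaled:
  assumes "I \<subseteq> V"
  shows "cobd (\<lambda>(l, I). monom_act 1 (nat (W (l, I) - m)) (\<zeta> l I)) (l, I) =
    monom_act 1 (nat (W (l, I) - m))
      (\<Sum>i\<in>I. monom_act (sg I i) 0 (\<zeta> (l(i := l i + 1)) (I - {i}) - \<zeta> l (I - {i})))"
proof -
  have *: "monom_act 1 (nat (W (l, I) - W d)) (monom_act 1 (nat (W d - m)) x) = monom_act 1 (nat (W (l, I) - m)) x"
    if "W d \<le> W (l, I)" "snd d \<subseteq> V" for d x
  proof -
    have "nat (W (l, I) - W d) + nat (W d - m) = nat (W (l, I) - m)"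
      using that W_lower_bound[of "snd d" "fst d"] by simp
    then show ?thesis
      by (simp add: monom_act_monom_act)
  qed
  have front: "W (l, I - {i}) \<le> W (l, I)" "W (l(i := l i + 1), I - {i}) \<le> W (l, I)" "I - {i} \<subseteq> V" if "i \<in> I" for i
    using W_front[OF assms that] W_back[OF assms that] assms by auto
  show ?thesis
    unfolding cobd_def prod.case monom_act_sum
  proof (intro sum.cong refl)
    fix i assume i: "i \<in> I"
    have comm: "monom_act (sg I i) 0 (monom_act 1 n y) = monom_act 1 n (monom_act (sg I i) 0 y)" for n y
      by (simp add: monom_act_monom_act)
    have "monom_act 1 (nat (W (l, I) - W (l(i := l i + 1), I - {i})))
        (monom_act 1 (nat (W (l(i := l i + 1), I - {i}) - m)) (\<zeta> (l(i := l i + 1)) (I - {i})))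
      - monom_act 1 (nat (W (l, I) - W (l, I - {i})))
        (monom_act 1 (nat (W (l, I - {i}) - m)) (\<zeta> l (I - {i})))
      = monom_act 1 (nat (W (l, I) - m)) (\<zeta> (l(i := l i + 1)) (I - {i}) - \<zeta> l (I - {i}))"
      using *[of "(l(i := l i + 1), I - {i})"] *[of "(l, I - {i})"] front[OF i] by (simp add: monom_act_diff)
    then show "monom_act (sg I i) 0
        (monom_act 1 (nat (W (l, I) - W (l(i := l i + 1), I - {i})))
          (monom_act 1 (nat (W (l(i := l i + 1), I - {i}) - m)) (\<zeta> (l(i := l i + 1)) (I - {i})))
        - monom_act 1 (nat (W (l, I) - W (l, I - {i})))
          (monom_act 1 (nat (W (l, I - {i}) - m)) (\<zeta> l (I - {i}))))
      = monom_act 1 (nat (W (l, I) - m)) (monom_act (sg I i) 0 (\<zeta> (l(i := l i + 1)) (I - {i}) - \<zeta> l (I - {i})))"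
      by (simp only: comm)
  qed
qed

lemma vanishing:
  assumes "B \<noteq> {}" "card B \<le> q" "cocycle q \<phi>"
  shows "\<exists>\<psi>. \<forall>c. snd c \<subseteq> V \<and> card (snd c) = q \<longrightarrow> cobd \<psi> c = \<phi> c"
proof (cases "card B = q")
  case False
  then obtain \<psi> where "bounds_on q (skeleton (Suc (card B))) \<phi> \<psi>"
    using bounds_skeleton[of "Suc (card B)" q \<phi>] assms by auto
  then show ?thesis
    unfolding skeleton_Suc_card bounds_on_def by auto
next
  case True
  obtain b where b: "b \<in> B"
    using assms(1) by auto
  obtain \<psi>0 where \<psi>0: "bounds_on q (skeleton (card B)) \<phi> \<psi>0"
    using bounds_skeleton assms by blast
  \<comment> \<open>After this correction only the cubes \<open>(l, B)\<close> can carry nonzero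
    values in degree \<open>q\<close>.\<close>
  define \<phi>1 where "\<phi>1 = (\<lambda>c. \<phi> c - cobd \<psi>0 c)"
  have \<phi>1_cocycle: "cocycle q \<phi>1"
    unfolding cocycle_def
  proof (intro allI impI, elim conjE)
    fix c :: "'a cube" assume c: "snd c \<subseteq> V" "card (snd c) = Suc q"
    then have "cobd \<phi> c = 0"
      using assms(3) by (simp only: cocycle_def)
    then show "cobd \<phi>1 c = 0"
      unfolding \<phi>1_def cobd_diff cobd_cobd[OF c(1)] by simp
  qed
  have \<phi>1_0: "\<phi>1 c = 0" if "c \<in> skeleton (card B)" "card (snd c) = q" for c
    using \<psi>0 that by (simp add: \<phi>1_def bounds_on_def)
  have "\<forall>i. \<exists>x. (\<forall>v. v \<notin> V - B \<longrightarrow> x v = i v) \<and>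
    extends q (skeleton (card B) \<union> {(x, B)}) (skeleton (card B) \<union> fiber B i)"
    using fiber_contract[OF order_refl] by blast
  then obtain x where x: "\<And>i v. v \<notin> V - B \<Longrightarrow> x i v = i v"
    "\<And>i. extends q (skeleton (card B) \<union> {(x i, B)}) (skeleton (card B) \<union> fiber B i)"
    by metis
  \<comment> \<open>Divides the value on the surviving cube by the power of \<open>U\<close> that
    \<open>cobd_scaled\<close> will produce; \<open>sg B b\<close> cancels the sign of direction
    \<open>b\<close> in \<open>cobd\<close>.\<close>
  define d where "d i = (SOME y. monom_act 1 (nat (W (x i, B) - m)) y = monom_act (sg B b) 0 (\<phi>1 (x i, B)))" for i
  have d: "monom_act 1 (nat (W (x i, B) - m)) (d i) = monom_act (sg B b) 0 (\<phi>1 (x i, B))" for i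
    unfolding d_def by (rule someI_ex[OF monom_act_surj])
  define g where "g j = (SOME g. \<forall>t. g (t + 1) - g t = d (j(b := t)))" for j
  have g: "g j (t + 1) - g j t = d (j(b := t))" for j t
    using someI_ex[OF int_primitive[of "\<lambda>t. d (j(b := t))"]] unfolding g_def by blast
  \<comment> \<open>\<open>i(b := 0)\<close> names the line through \<open>i\<close> in direction
    \<open>b\<close>, so neighbours on that line use the same primitive.\<close>
  define z where "z i = g (i(b := 0)) (i b)" for i
  have z: "z (i(b := i b + 1)) - z i = d i" for i
    using g[of "i(b := 0)" "i b"] by (simp add: z_def)
  define proj :: "(_ \<Rightarrow> int) \<Rightarrow> _ \<Rightarrow> int" where "proj l v = (if v \<in> V - B then 0 else l v)" for l v
  define \<zeta> where "\<zeta> l I = (if I = B - {b} then z (proj l) else 0)" for l I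
  \<comment> \<open>Being \<open>U\<close> to the power \<open>W - m\<close> times a constant on each fibre, \<open>\<psi>1\<close> has no coboundary
    along the good directions; only the direction \<open>b\<close> remains.\<close>
  define \<psi>1 where "\<psi>1 = (\<lambda>(l, I). monom_act 1 (nat (W (l, I) - m)) (\<zeta> l I))"
  have on_skeleton: "cobd \<psi>1 c = 0" if c: "c \<in> skeleton (card B)" for c
  proof -
    obtain l I where lI: "c = (l, I)" by (cases c)
    have I: "I \<subseteq> V" "I \<noteq> B"
      using c by (auto simp: lI skeleton_def)
    have "\<zeta> (l(i := l i + 1)) (I - {i}) = \<zeta> l (I - {i})" if i: "i \<in> I" for i
    proof (cases "I - {i} = B - {b}")
      case True
      \<comment> \<open>A bad direction whose removal leaves \<open>B - {b}\<close> would have to be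
        \<open>b\<close> itself, and then \<open>I = B\<close>.\<close>
      then have "i \<notin> B"
        using I(2) b i by blast
      then have "proj (l(i := l i + 1)) = proj l"
        using I(1) i by (auto simp: proj_def fun_eq_iff)
      then show ?thesis
        by (simp add: \<zeta>_def)
    qed (simp add: \<zeta>_def)
    then show ?thesis
      unfolding lI \<psi>1_def cobd_scaled[OF I(1)] by simp
  qed
  have on_B: "cobd \<psi>1 (x i, B) = \<phi>1 (x i, B)" if i: "\<And>v. v \<in> V - B \<Longrightarrow> i v = 0" for i
  proof -
    have proj: "proj (x i) = i" "proj ((x i)(b := x i b + 1)) = i(b := i b + 1)"
      using i x(1)[of _ i] b by (auto simp: proj_def fun_eq_iff)
    have "\<zeta> ((x i)(j := x i j + 1)) (B - {j}) - \<zeta> (x i) (B - {j}) = (if j = b then d i else 0)" if "j \<in> B" for j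
    proof (cases "j = b")
      case True
      then show ?thesis
        unfolding \<zeta>_def using proj z[of i] by simp
    next
      case False
      then have "B - {j} \<noteq> B - {b}"
        using that b by blast
      with False show ?thesis
        by (simp add: \<zeta>_def)
    qed
    then have "(\<Sum>j\<in>B. monom_act (sg B j) 0 (\<zeta> ((x i)(j := x i j + 1)) (B - {j}) - \<zeta> (x i) (B - {j})))
      = (\<Sum>j\<in>B. if j = b then monom_act (sg B b) 0 (d i) else 0)"
      by (intro sum.cong) (auto simp del: fun_upd_apply)
    also have "\<dots> = monom_act (sg B b) 0 (d i)"
      using b finite_B by simp
    finally have "cobd \<psi>1 (x i, B) = monom_act (sg B b) 0 (monom_act 1 (nat (W (x i, B) - m)) (d i))"
      unfolding \<psi>1_def cobd_scaled[OF B_V] by (simp add: monom_act_monom_act)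
    then show ?thesis
      by (simp add: d monom_act_monom_act sg_sq)
  qed
  have \<psi>1: "cobd \<psi>1 c = \<phi>1 c" if c: "snd c \<subseteq> V" "card (snd c) = q" for c
  proof (cases "c \<in> skeleton (card B)")
    case True
    then show ?thesis
      using on_skeleton \<phi>1_0 c by simp
  next
    case False
    obtain l I where lI: "c = (l, I)" by (cases c)
    have "finite I"
      using c(1) finite_V finite_subset lI by auto
    have "\<not> card (I \<inter> B) < card B"
      using False c(1) by (auto simp: lI skeleton_def)
    then have "I \<inter> B = B"
      by (meson finite_B Int_lower2 card_seteq leI)
    then have I: "I = B"
      using card_seteq[OF \<open>finite I\<close>, of B] c(2) True by (auto simp: lI)
    define i where "i = proj l"
    have "bounds_on q (skeleton (card B) \<union> {(x i, B)}) \<phi>1 \<psi>1"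
      using on_skeleton \<phi>1_0 on_B[of i] by (auto simp: bounds_on_def i_def proj_def)
    \<comment> \<open>The equation at the single cube \<open>(x i, B)\<close> controls the whole
      fibre: some extension \<open>\<psi>'\<close> solves all equations there, and a cube
      \<open>(l, B)\<close> has all its faces in the skeleton, where \<open>\<psi>'\<close> and
      \<open>\<psi>1\<close> agree.\<close>
    then obtain \<psi>' where \<psi>': "\<And>c. c \<in> skeleton (card B) \<union> {(x i, B)} \<Longrightarrow> \<psi>' c = \<psi>1 c"
      "bounds_on q (skeleton (card B) \<union> fiber B i) \<phi>1 \<psi>'"
      using extendsD[OF x(2) \<phi>1_cocycle] by metis
    have "(l, B) \<in> fiber B i"
      using B_V by (auto simp: fiber_def i_def proj_def)
    then have "\<phi>1 c = cobd \<psi>' c"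
      using \<psi>'(2) True by (auto simp: bounds_on_def lI I)
    also have "\<dots> = cobd \<psi>1 c"
    proof (rule cobd_cong)
      fix d assume "is_face d c"
      then have "d \<in> skeleton (card B)"
        unfolding lI I using B_V by (cases rule: face_cases) auto
      then show "\<psi>' d = \<psi>1 d"
        by (intro \<psi>'(1)) simp
    qed
    finally show ?thesis ..
  qed
  have "cobd (\<lambda>c. \<psi>0 c - (0 - \<psi>1 c)) c = \<phi> c" if "snd c \<subseteq> V" "card (snd c) = q" for c
  proof -
    have "cobd (\<lambda>c. 0) c = 0"
      by (cases c) (simp add: cobd_def)
    then show ?thesis
      using \<psi>1[OF that] by (simp only: cobd_diff) (simp add: \<phi>1_def)
  qed
  then show ?thesis
    by blast
qed

end

section \<open>Plumbing lattices\<close>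

text \<open>Elimination of one index \<open>s\<close>. The vector \<open>e\<close> is annihilated by
  the rows in \<open>T\<close>, and row \<open>s\<close> takes it to the Schur complement
  \<open>n\<close>. The quadratic form at \<open>e\<close> equals \<open>n\<close>, so anisotropy
  gives \<open>n \<noteq> 0\<close>, and a multiple of \<open>e\<close> corrects row
  \<open>s\<close> without disturbing the others.\<close>

lemma solve_linear_system:
  fixes A :: "'a \<Rightarrow> 'a \<Rightarrow> 'b::field"
  assumes "finite S"
    and "\<And>x. \<exists>v\<in>S. x v \<noteq> 0 \<Longrightarrow> (\<Sum>i\<in>S. \<Sum>j\<in>S. x i * x j * A i j) \<noteq> 0"
  shows "\<exists>x. (\<forall>v. v \<notin> S \<longrightarrow> x v = 0) \<and> (\<forall>i\<in>S. (\<Sum>j\<in>S. A i j * x j) = b i)"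
  using assms
proof (induction S arbitrary: b rule: finite_induct)
  case (insert s T)
  have "(\<Sum>i\<in>T. \<Sum>j\<in>T. x i * x j * A i j) \<noteq> 0" if "\<exists>v\<in>T. x v \<noteq> 0" for x
  proof -
    define y where "y = x(s := 0)"
    have "(\<Sum>i\<in>insert s T. \<Sum>j\<in>insert s T. y i * y j * A i j) \<noteq> 0"
      using that insert.hyps(2) by (intro insert.prems) (auto simp: y_def)
    also have "(\<Sum>i\<in>insert s T. \<Sum>j\<in>insert s T. y i * y j * A i j) = (\<Sum>i\<in>T. \<Sum>j\<in>T. y i * y j * A i j)"
      using insert.hyps by (simp add: y_def)
    also have "\<dots> = (\<Sum>i\<in>T. \<Sum>j\<in>T. x i * x j * A i j)"
      using insert.hyps by (intro sum.cong) (auto simp: y_def)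
    finally show ?thesis .
  qed
  note IH = insert.IH[OF this]
  obtain u where u: "\<And>v. v \<notin> T \<Longrightarrow> u v = 0" "\<And>i. i \<in> T \<Longrightarrow> (\<Sum>j\<in>T. A i j * u j) = A i s"
    using IH[of "\<lambda>i. A i s"] by blast
  obtain y where y: "\<And>v. v \<notin> T \<Longrightarrow> y v = 0" "\<And>i. i \<in> T \<Longrightarrow> (\<Sum>j\<in>T. A i j * y j) = b i"
    using IH[of b] by blast
  define e where "e v = (if v = s then 1 else - u v)" for v
  define n where "n = A s s - (\<Sum>j\<in>T. A s j * u j)"
  have e_T: "(\<Sum>j\<in>T. A i j * e j) = - (\<Sum>j\<in>T. A i j * u j)" for i
    unfolding sum_negf[symmetric] using insert.hyps(2) by (intro sum.cong) (auto simp: e_def)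
  have Ae: "(\<Sum>j\<in>insert s T. A i j * e j) = (if i = s then n else 0)" if "i \<in> insert s T" for i
    using that insert.hyps e_T[of i] u(2)[of i] by (auto simp: e_def n_def)
  have y_T: "(\<Sum>j\<in>insert s T. A i j * y j) = (\<Sum>j\<in>T. A i j * y j)" for i
    using insert.hyps y(1)[of s] by simp
  have "n \<noteq> 0"
  proof
    assume "n = 0"
    have "(\<Sum>i\<in>insert s T. \<Sum>j\<in>insert s T. e i * e j * A i j) =
      (\<Sum>i\<in>insert s T. e i * (\<Sum>j\<in>insert s T. A i j * e j))"
      unfolding sum_distrib_left by (intro sum.cong) (auto simp: mult_ac)
    also have "\<dots> = 0"
      using Ae \<open>n = 0\<close> by (intro sum.neutral) auto
    finally show False
      using insert.prems[of e] by (auto simp: e_def)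
  qed
  define t where "t = (b s - (\<Sum>j\<in>T. A s j * y j)) / n"
  define x where "x v = y v + t * e v" for v
  have "(\<Sum>j\<in>insert s T. A i j * x j) = (\<Sum>j\<in>insert s T. A i j * y j) + t * (\<Sum>j\<in>insert s T. A i j * e j)" for i
    unfolding sum_distrib_left sum.distrib[symmetric] by (intro sum.cong) (auto simp: x_def algebra_simps)
  note Ax = this
  have "(\<Sum>j\<in>insert s T. A i j * x j) = b i" if "i \<in> insert s T" for i
    unfolding Ax[of i] y_T Ae[OF that] using that \<open>n \<noteq> 0\<close> y(2)[of i] by (auto simp: t_def)
  moreover have "x v = 0" if "v \<notin> insert s T" for v
    using that y(1)[of v] u(1)[of v] by (auto simp: x_def e_def)
  ultimately show ?case
    by blast
qed auto

lemma common_denominator: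
  fixes x :: "'a \<Rightarrow> rat"
  assumes "finite S"
  shows "\<exists>D>0. \<exists>y. \<forall>v\<in>S. of_int D * x v = of_int (y v)"
  using assms
proof (induction S rule: finite_induct)
  case (insert s S)
  then obtain D y where D: "D > 0" "\<And>v. v \<in> S \<Longrightarrow> of_int D * x v = of_int (y v)"
    by blast
  obtain p q where q: "x s = Fract p q" "q > 0"
    by (cases "x s")
  have xs: "of_int q * x s = of_int p"
    using q by (simp add: Fract_of_int_quotient)
  define z where "z = (\<lambda>v. if v = s then D * p else q * y v)"
  have "of_int (D * q) * x v = of_int (z v)" if "v \<in> insert s S" for v
  proof (cases "v = s")
    case True
    then show ?thesis
      using xs by (simp add: z_def mult.assoc)
  next
    case False
    then show ?thesis
      using D(2)[of v] that by (simp add: z_def algebra_simps)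
  qed
  moreover have "D * q > 0"
    using D q by simp
  ultimately show ?case
    by blast
qed (auto intro: exI[of _ 1])

section \<open>The intersection form and the canonical class\<close>

lemma form_pairing: "form G x y = (\<Sum>j\<in>verts G. y j * (\<Sum>i\<in>verts G. x i * of_int (entry G i j)))"
  unfolding form_def by (subst sum.swap) (auto simp: sum_distrib_left mult_ac intro!: sum.cong)

lemma entry_commute: "entry G i j = entry G j i"
  by (auto simp: entry_def adjacent_def insert_commute)

lemma form_commute: "form G x y = form G y x"
  unfolding form_def by (subst sum.swap) (auto simp: entry_commute mult_ac intro!: sum.cong)

lemma form_add: "form G x (\<lambda>v. y v + z v) = form G x y + form G x z"
  by (simp add: form_def algebra_simps sum.distrib)

lemma form_scale: "form G x (\<lambda>v. r * y v) = r * form G x y"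
  by (simp add: form_def sum_distrib_left mult_ac)

lemma form_add_left: "form G (\<lambda>v. x v + y v) z = form G x z + form G y z"
  by (simp add: form_def algebra_simps sum.distrib)

lemma form_scale_left: "form G (\<lambda>v. r * x v) y = r * form G x y"
  by (simp add: form_def sum_distrib_left mult_ac)

lemma form_cong:
  "(\<And>v. v \<in> verts G \<Longrightarrow> x v = x' v) \<Longrightarrow> (\<And>v. v \<in> verts G \<Longrightarrow> y v = y' v) \<Longrightarrow> form G x y = form G x' y'"
  by (simp add: form_def)

lemma form_E:
  assumes "finite (verts G)" "j \<in> verts G"
  shows "form G x (ratv (E j)) = (\<Sum>i\<in>verts G. x i * of_int (entry G i j))"
proof -
  have "form G x (ratv (E j)) =
    (\<Sum>i\<in>verts G. if i = j then (\<Sum>k\<in>verts G. x k * of_int (entry G k j)) else 0)"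
    unfolding form_pairing by (intro sum.cong) (auto simp: ratv_def E_def)
  then show ?thesis
    using assms by simp
qed

text \<open>A common denominator brings a rational vector into the lattice and scales the form by a
  positive square.\<close>

lemma negative_definite_rat:
  assumes "finite (verts G)" "negative_definite G" "v \<in> verts G" "x v \<noteq> 0"
  shows "form G x x < 0"
proof -
  obtain D y where D: "D > 0" "\<And>v. v \<in> verts G \<Longrightarrow> of_int D * x v = of_int (y v)"
    using common_denominator[OF assms(1), of x] by blast
  define l where "l v = (if v \<in> verts G then y v else 0)" for v
  have "form G (ratv l) (ratv l) = form G (\<lambda>v. of_int D * x v) (\<lambda>v. of_int D * x v)"
    using D(2) by (intro form_cong) (auto simp: l_def ratv_def)
  also have "\<dots> = (of_int D)\<^sup>2 * form G x x"
    unfolding form_scale form_scale_left by (simp add: power2_eq_square)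
  finally have "form G (ratv l) (ratv l) = (of_int D)\<^sup>2 * form G x x" .
  moreover have "l v \<noteq> 0"
    using D(2)[OF assms(3)] D(1) assms(3,4) by (auto simp: l_def)
  then have "l \<noteq> (\<lambda>v. 0)"
    by auto
  moreover have "l \<in> int_lattice G"
    by (simp add: int_lattice_def l_def)
  then have "l \<noteq> (\<lambda>v. 0) \<longrightarrow> form G (ratv l) (ratv l) < 0"
    using assms(2) unfolding negative_definite_def by blast
  ultimately show ?thesis
    using D(1) by (simp add: mult_less_0_iff)
qed

lemma form_nonpos:
  assumes "finite (verts G)" "negative_definite G"
  shows "form G x x \<le> 0"
proof (cases "\<exists>v\<in>verts G. x v \<noteq> 0")
  case True
  then show ?thesis
    using negative_definite_rat[OF assms] by force
next
  case False
  then have "form G x x = 0"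
    by (auto simp: form_def intro!: sum.neutral)
  then show ?thesis
    by simp
qed

text \<open>A definite description can be used only after existence and uniqueness. The linear
  system yields a candidate, which is dual because it pairs integrally with the basis; the
  difference of two candidates is orthogonal to everything, hence zero.\<close>

lemma k_can_form:
  assumes "finite (verts G)" "negative_definite G" "j \<in> verts G"
  shows "form G (k_can G) (ratv (E j)) = of_int (- euler G j - 2)"
proof -
  let ?P = "\<lambda>k. k \<in> dual_lattice G \<and>
     (\<forall>j\<in>verts G. form G k (ratv (E j)) = - form G (ratv (E j)) (ratv (E j)) - 2)"
  have EE: "form G (ratv (E j)) (ratv (E j)) = of_int (euler G j)" if "j \<in> verts G" for j
  proof -
    have "form G (ratv (E j)) (ratv (E j)) = (\<Sum>i\<in>verts G. if i = j then of_int (euler G j) else 0)"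
      unfolding form_E[OF assms(1) that] by (intro sum.cong) (auto simp: ratv_def E_def entry_def)
    then show ?thesis
      using assms(1) that by simp
  qed
  have nd: "(\<Sum>i\<in>verts G. \<Sum>j\<in>verts G. x i * x j * rat_of_int (entry G i j)) \<noteq> 0" if x: "\<exists>v\<in>verts G. x v \<noteq> 0" for x
  proof -
    obtain v where "v \<in> verts G" "x v \<noteq> 0"
      using x by blast
    then show ?thesis
      using negative_definite_rat[OF assms(1,2), of v x] by (simp add: form_def)
  qed
  obtain k where k: "\<And>v. v \<notin> verts G \<Longrightarrow> k v = 0"
    "\<And>i. i \<in> verts G \<Longrightarrow> (\<Sum>j\<in>verts G. rat_of_int (entry G i j) * k j) = - of_int (euler G i) - 2"
    using solve_linear_system[OF assms(1) nd, of "\<lambda>i. - of_int (euler G i) - 2"] by blast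
  have kE: "form G k (ratv (E j)) = - of_int (euler G j) - 2" if "j \<in> verts G" for j
    unfolding k(2)[OF that, symmetric] form_E[OF assms(1) that]
    by (intro sum.cong refl) (simp add: entry_commute[of G j])
  have "form G k (ratv l) \<in> \<int>" for l
  proof -
    have "form G k (ratv l) = (\<Sum>j\<in>verts G. of_int (l j) * form G k (ratv (E j)))"
      unfolding form_pairing[of G k "ratv l"] using form_E[OF assms(1)] by (intro sum.cong) (auto simp: ratv_def)
    also have "\<dots> \<in> \<int>"
      using kE by (intro Ints_sum) auto
    finally show ?thesis .
  qed
  then have P: "?P k"
    using k(1) kE EE by (auto simp: dual_lattice_def rat_lattice_def)
  moreover have "k' = k" if "?P k'" for k'
  proof -
    define d where "d = (\<lambda>v. k' v + - 1 * k v)"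
    have "form G d (ratv (E j)) = 0" if "j \<in> verts G" for j
      using \<open>?P k'\<close> P that unfolding d_def form_add_left form_scale_left by simp
    then have "form G d d = 0"
      unfolding form_pairing[of G d d] using form_E[OF assms(1), of _ d] by (intro sum.neutral) auto
    then have "d v = 0" if "v \<in> verts G" for v
      using negative_definite_rat[OF assms(1,2) that, of d] by auto
    moreover have "d v = 0" if "v \<notin> verts G" for v
      using that \<open>?P k'\<close> k(1)[OF that] by (auto simp: d_def dual_lattice_def rat_lattice_def)
    ultimately have "k' v = k v" for v
      by (cases "v \<in> verts G") (auto simp: d_def)
    then show ?thesis
      by blast
  qed
  ultimately have "?P (k_can G)"
    unfolding k_can_def by (rule theI)
  then show ?thesis
    using assms(3) EE by auto
qed

section \<open>From rationality and definiteness to the combinatorial hypotheses\<close>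

definition pairing :: "('v, 'b) plumbing_graph_scheme \<Rightarrow> ('v \<Rightarrow> int) \<Rightarrow> 'v \<Rightarrow> int" where
  "pairing G l v = (\<Sum>u\<in>verts G. l u * entry G u v)"

lemma form_ratv: "form G (ratv l) y = (\<Sum>j\<in>verts G. y j * of_int (pairing G l j))"
  by (simp add: form_pairing pairing_def ratv_def)

text \<open>
  For \<open>Y j \<in> {0, 1}\<close> the decoration at \<open>j\<close> enters \<open>\<chi>\<^sub>c\<^sub>a\<^sub>n(Y)\<close> through \<open>(Y j)\<^sup>2 - Y j = 0\<close>, so that
  the modified decorations may be replaced by the original ones.
\<close>

lemma bad_vertices_laufer:
  assumes B: "B \<subseteq> verts G" and e'_eq: "\<forall>j. j \<notin> B \<longrightarrow> e' j = euler G j"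
    and rational: "rational_graph (G\<lparr>euler := e'\<rparr>)"
    and Y: "\<forall>v\<in>verts G. 0 \<le> Y v" "\<exists>v\<in>verts G. 0 < Y v" "\<forall>v\<in>B. Y v \<le> 1"
  shows "\<exists>v\<in>verts G. 0 < Y v \<and> pairing G Y v \<le> entry G v v + 1"
proof -
  let ?G = "G\<lparr>euler := e'\<rparr>"
  have fin: "finite (verts G)" and nd: "negative_definite ?G"
    using rational plumbing_tree.finite_verts[of ?G] by (auto simp: rational_graph_def)
  define l where "l v = (if v \<in> verts G then Y v else 0)" for v
  obtain w where "w \<in> verts G" "0 < Y w"
    using Y(2) by blast
  then have "l w \<noteq> 0"
    by (simp add: l_def)
  then have "l \<noteq> (\<lambda>v. 0)"
    by auto
  moreover have "l \<in> int_lattice ?G" "\<forall>v. 0 \<le> l v"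
    using Y(1) by (auto simp: int_lattice_def l_def)
  ultimately have pos: "0 < chi ?G (k_can ?G) l"
    using rational unfolding rational_graph_def by blast
  have "form ?G (k_can ?G) (ratv l) = (\<Sum>j\<in>verts G. of_int (l j) * form ?G (k_can ?G) (ratv (E j)))"
    unfolding form_pairing[of ?G _ "ratv l"] using form_E[of ?G] fin by (intro sum.cong) (auto simp: ratv_def)
  also have "\<dots> = (\<Sum>j\<in>verts G. of_int (l j * (- e' j - 2)))"
    using k_can_form[of ?G] fin nd by (intro sum.cong) auto
  finally have kl: "form ?G (ratv l) (k_can ?G) = (\<Sum>j\<in>verts G. of_int (l j * (- e' j - 2)))"
    by (simp add: form_commute)
  have pair: "pairing ?G l j = pairing G Y j + Y j * (e' j - euler G j)" if "j \<in> verts G" for j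
  proof -
    have "pairing ?G l j = (\<Sum>u\<in>verts G. Y u * entry G u j + (if u = j then Y j * (e' j - euler G j) else 0))"
      unfolding pairing_def by (intro sum.cong) (auto simp: entry_def l_def adjacent_def algebra_simps)
    then show ?thesis
      using that fin by (simp add: pairing_def sum.distrib)
  qed
  have "form ?G (ratv l) (ratv l) = (\<Sum>j\<in>verts G. of_int (Y j * (pairing G Y j + Y j * (e' j - euler G j))))"
    unfolding form_ratv using pair by (auto intro!: sum.cong simp: ratv_def l_def)
  then have "form ?G (ratv l) (\<lambda>v. ratv l v + k_can ?G v) =
    (\<Sum>j\<in>verts G. of_int (Y j * (pairing G Y j + Y j * (e' j - euler G j)) + Y j * (- e' j - 2)))"
    unfolding form_add kl by (auto simp: sum.distrib[symmetric] l_def intro!: sum.cong)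
  also have "\<dots> = (\<Sum>j\<in>verts G. of_int (Y j * (pairing G Y j - euler G j - 2)))"
  proof (intro sum.cong refl arg_cong[where f = of_int])
    fix j assume j: "j \<in> verts G"
    have "Y j * Y j * (e' j - euler G j) = Y j * (e' j - euler G j)"
    proof (cases "j \<in> B")
      case True
      then have "Y j = 0 \<or> Y j = 1"
        using Y j by force
      then show ?thesis
        by auto
    qed (use e'_eq in simp)
    then show "Y j * (pairing G Y j + Y j * (e' j - euler G j)) + Y j * (- e' j - 2) = Y j * (pairing G Y j - euler G j - 2)"
      by (simp add: algebra_simps)
  qed
  finally have "rat_of_int (\<Sum>j\<in>verts G. Y j * (pairing G Y j - euler G j - 2)) < 0"
    using pos by (simp add: chi_def)
  then have neg: "(\<Sum>j\<in>verts G. Y j * (pairing G Y j - euler G j - 2)) < 0"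
    by linarith
  \<comment> \<open>As \<open>Y\<close> is nonnegative, some factor with \<open>Y j > 0\<close> must
    be negative: the pairing there is below \<open>euler G j + 2\<close>.\<close>
  show ?thesis
  proof (rule ccontr)
    assume contr: "\<not> ?thesis"
    have "0 \<le> Y j * (pairing G Y j - euler G j - 2)" if "j \<in> verts G" for j
    proof (cases "Y j = 0")
      case False
      then have "0 < Y j"
        using Y(1) that by force
      then have "entry G j j + 1 < pairing G Y j"
        using contr that by force
      then show ?thesis
        using \<open>0 < Y j\<close> by (simp add: entry_def)
    qed simp
    then show False
      using neg sum_nonneg[of "verts G" "\<lambda>j. Y j * (pairing G Y j - euler G j - 2)"] by force
  qed
qed

text \<open>Solve for pairing -1 at every vertex of \<open>N\<close> and clear denominators. Write
  \<open>Z = P - n\<close> with positive part \<open>P\<close> and negative part \<open>n\<close>.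
  These have disjoint supports, so \<open>n \<noteq> 0\<close> would give
  \<open>(Z, n) = (P, n) - (n, n) > 0\<close>, although \<open>Z\<close> pairs negatively on
  \<open>N\<close>. An entry 0 at \<open>v\<close> would make the pairing at \<open>v\<close>
  nonnegative.\<close>

lemma anti_nef_vector:
  assumes fin: "finite (verts G)" and nd: "negative_definite G" and N: "N \<subseteq> verts G"
  obtains Z where "\<And>v. v \<notin> N \<Longrightarrow> Z v = 0" "\<And>v. v \<in> N \<Longrightarrow> 0 < Z v" "\<And>v. v \<in> N \<Longrightarrow> pairing G Z v < 0"
proof -
  have finN: "finite N"
    using fin N finite_subset by auto
  have nd_N: "(\<Sum>i\<in>N. \<Sum>j\<in>N. x i * x j * rat_of_int (entry G j i)) \<noteq> 0" if x: "\<exists>v\<in>N. x v \<noteq> 0" for x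
  proof -
    define y where "y v = (if v \<in> N then x v else 0)" for v
    have "form G y y = (\<Sum>i\<in>N. \<Sum>j\<in>N. y i * y j * rat_of_int (entry G i j))"
      unfolding form_def using fin N
      by (intro sum.mono_neutral_cong_right ballI sum.neutral) (auto simp: y_def)
    also have "\<dots> = (\<Sum>i\<in>N. \<Sum>j\<in>N. x i * x j * rat_of_int (entry G j i))"
      by (intro sum.cong refl) (simp add: y_def entry_commute)
    finally have eq: "form G y y = (\<Sum>i\<in>N. \<Sum>j\<in>N. x i * x j * rat_of_int (entry G j i))" .
    obtain v where "v \<in> N" "x v \<noteq> 0"
      using x by blast
    then have "form G y y < 0"
      using N by (intro negative_definite_rat[OF fin nd, of v]) (auto simp: y_def)
    with eq show ?thesis
      by simp
  qed
  obtain x where x: "\<And>v. v \<notin> N \<Longrightarrow> x v = 0" "\<And>i. i \<in> N \<Longrightarrow> (\<Sum>j\<in>N. rat_of_int (entry G j i) * x j) = - 1"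
    using solve_linear_system[OF finN nd_N, of "\<lambda>_. - 1"] by blast
  obtain D y where D: "D > 0" "\<And>v. v \<in> N \<Longrightarrow> of_int D * x v = of_int (y v)"
    using common_denominator[OF finN, of x] by blast
  define Z where "Z v = (if v \<in> N then y v else 0)" for v
  have Z0: "Z v = 0" if "v \<notin> N" for v
    using that by (simp add: Z_def)
  have pZ: "pairing G Z v = - D" if "v \<in> N" for v
  proof -
    have "pairing G Z v = (\<Sum>u\<in>N. y u * entry G u v)"
      unfolding pairing_def using fin N by (intro sum.mono_neutral_cong_right) (auto simp: Z_def)
    then have "rat_of_int (pairing G Z v) = (\<Sum>u\<in>N. of_int D * (of_int (entry G u v) * x u))"
      using D(2)[symmetric] by (auto intro!: sum.cong)
    also have "\<dots> = of_int (- D)"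
      using x(2)[OF that] by (simp flip: sum_distrib_left)
    finally show ?thesis
      by (simp only: of_int_eq_iff)
  qed
  have off: "0 \<le> entry G u v" if "u \<noteq> v" for u v
    using that by (simp add: entry_def)
  have nonneg: "0 \<le> Z v" for v
  proof (rule ccontr)
    assume v: "\<not> 0 \<le> Z v"
    then have "v \<in> N"
      using Z0[of v] by auto
    define n where "n u = max 0 (- Z u)" for u
    define P where "P u = max 0 (Z u)" for u
    have Z_split: "Z u = P u + - 1 * n u" for u
      by (auto simp: P_def n_def)
    have nn: "form G (ratv n) (ratv n) < 0"
      using v \<open>v \<in> N\<close> N by (intro negative_definite_rat[OF fin nd, of v]) (auto simp: n_def ratv_def)
    have "form G (ratv Z) (ratv n) = form G (ratv P) (ratv n) - form G (ratv n) (ratv n)"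
    proof -
      have "ratv Z = (\<lambda>u. ratv P u + - 1 * ratv n u)"
        unfolding ratv_def Z_split by auto
      then show ?thesis
        by (simp only: form_add_left form_scale_left)
    qed
    moreover have "0 \<le> form G (ratv P) (ratv n)"
      unfolding form_def
    proof (intro sum_nonneg)
      fix i j
      have "P i = 0 \<or> n i = 0" "0 \<le> P i" "0 \<le> n j"
        by (auto simp: P_def n_def)
      then show "0 \<le> ratv P i * ratv n j * rat_of_int (entry G i j)"
        using off[of i j] by (cases "i = j") (auto simp: ratv_def)
    qed
    moreover have "form G (ratv Z) (ratv n) \<le> 0"
      unfolding form_ratv
    proof (intro sum_nonpos)
      fix j
      show "ratv n j * rat_of_int (pairing G Z j) \<le> 0"
        using pZ[of j] D(1) Z0[of j] by (cases "j \<in> N") (auto simp: n_def ratv_def mult_nonneg_nonpos)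
    qed
    ultimately show False
      using nn by simp
  qed
  have "Z v \<noteq> 0" if "v \<in> N" for v
  proof
    assume "Z v = 0"
    then have "0 \<le> pairing G Z v"
      unfolding pairing_def using nonneg off by (intro sum_nonneg) (metis mult_nonneg_nonneg mult_zero_left order_refl)
    with pZ[OF that] D(1) show False
      by simp
  qed
  then have "0 < Z v" if "v \<in> N" for v
    using nonneg[of v] that by force
  then show ?thesis
    using that[of Z] Z0 pZ D(1) by simp
qed

text \<open>Completing the square with \<open>h = l + k/2\<close> gives
  \<open>\<chi>\<^sub>k(l) = - (h, h)/2 + (k, k)/8\<close>.\<close>

lemma chi_ge:
  assumes "finite (verts G)" "negative_definite G"
  shows "form G k k / 8 \<le> chi G k l"
proof -
  define h where "h = (\<lambda>v. ratv l v + (1/2) * k v)"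
  have "form G h h = form G (ratv l) (ratv l) + form G (ratv l) k + form G k k / 4"
    unfolding h_def form_add form_add_left form_scale form_scale_left
    using form_commute[of G k "ratv l"] by simp
  then have "chi G k l = - form G h h / 2 + form G k k / 8"
    unfolding chi_def form_add by (simp add: field_simps)
  then show ?thesis
    using form_nonpos[OF assms, of h] by simp
qed

lemma chi_restrict: "chi G k (\<lambda>v. if v \<in> verts G then l v else 0) = chi G k l"
  unfolding chi_def by (intro arg_cong[where f = "\<lambda>x. - x / 2"] form_cong) (auto simp: ratv_def)

lemma chi_integral:
  assumes "k \<in> characteristic_elements G"
  shows "chi G k l = of_int \<lfloor>chi G k l\<rfloor>"
proof -
  define l' where "l' = (\<lambda>v. if v \<in> verts G then l v else 0)"
  have "l' \<in> int_lattice G"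
    by (simp add: l'_def int_lattice_def)
  then obtain n :: int where "form G k (ratv l') + form G (ratv l') (ratv l') = 2 * of_int n"
    using assms unfolding characteristic_elements_def by blast
  then have "chi G k l' = of_int (- n)"
    unfolding chi_def form_add using form_commute[of G k "ratv l'"] by simp
  moreover have "chi G k l' = chi G k l"
    unfolding l'_def by (rule chi_restrict)
  ultimately show ?thesis
    by (metis floor_of_int)
qed

lemma chi_add_E:
  assumes "finite (verts G)" "v \<in> verts G"
  shows "chi G k (l(v := l v + 1)) = chi G k l + chi G k (E v) - of_int (pairing G l v)"
proof -
  have "ratv (l(v := l v + 1)) = (\<lambda>u. ratv l u + ratv (E v) u)"
    by (auto simp: ratv_def E_def)
  moreover have "form G (ratv l) (ratv (E v)) = of_int (pairing G l v)"
    using form_E[OF assms, of "ratv l"] by (simp add: pairing_def ratv_def)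
  moreover have "form G (ratv (E v)) (ratv l) = form G (ratv l) (ratv (E v))"
    by (rule form_commute)
  ultimately show ?thesis
    unfolding chi_def form_add by (simp only: form_add form_add_left) (simp add: field_simps)
qed

lemma negative_lattice_weight_graph:
  assumes fin: "finite (verts G)" and nd: "negative_definite G"
    and k: "k \<in> characteristic_elements G" and B: "B \<subseteq> verts G" and e'_eq: "\<forall>j. j \<notin> B \<longrightarrow> e' j = euler G j"
    and rational: "rational_graph (G\<lparr>euler := e'\<rparr>)"
  shows "\<exists>Z m. negative_lattice_weight (verts G) B (entry G) (\<lambda>v. \<lfloor>chi G k (E v)\<rfloor>) (\<lambda>l. \<lfloor>chi G k l\<rfloor>) Z m"
proof -
  obtain Z where Z: "\<And>v. v \<notin> verts G - B \<Longrightarrow> Z v = 0" "\<And>v. v \<in> verts G - B \<Longrightarrow> 0 < Z v"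
    "\<And>v. v \<in> verts G - B \<Longrightarrow> pairing G Z v < 0"
    using anti_nef_vector[OF fin nd, of "verts G - B"] by blast
  have "negative_lattice_weight (verts G) B (entry G) (\<lambda>v. \<lfloor>chi G k (E v)\<rfloor>) (\<lambda>l. \<lfloor>chi G k l\<rfloor>) Z
    \<lfloor>form G k k / 8\<rfloor>"
  proof (unfold_locales, fold pairing_def)
    show "finite (verts G)" "B \<subseteq> verts G"
      by fact+
    show "0 \<le> entry G u v" if "u \<noteq> v" for u v
      using that by (simp add: entry_def)
    show "\<lfloor>chi G k (l(v := l v + 1))\<rfloor> = \<lfloor>chi G k l\<rfloor> + \<lfloor>chi G k (E v)\<rfloor> - pairing G l v" if "v \<in> verts G" for l v
      using chi_add_E[OF fin that, of k l] chi_integral[OF k, of l] chi_integral[OF k, of "E v"]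
        chi_integral[OF k, of "l(v := l v + 1)"] by linarith
    show "\<exists>v\<in>verts G. 0 < Y v \<and> pairing G Y v \<le> entry G v v + 1"
      if "\<forall>v\<in>verts G. 0 \<le> Y v" "\<exists>v\<in>verts G. 0 < Y v" "\<forall>v\<in>B. Y v \<le> 1" for Y
      using bad_vertices_laufer[OF B e'_eq rational that] .
    show "(\<Sum>v\<in>verts G. d v * pairing G d v) < 0"
      if "\<forall>v. v \<notin> verts G - B \<longrightarrow> d v = 0" "d \<noteq> (\<lambda>v. 0)" for d
    proof -
      have "form G (ratv d) (ratv d) < 0"
        using nd that by (auto simp: negative_definite_def int_lattice_def)
      then have "rat_of_int (\<Sum>v\<in>verts G. d v * pairing G d v) < 0"
        unfolding form_ratv by (simp add: ratv_def)
      then show ?thesis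
        by linarith
    qed
    show "\<lfloor>form G k k / 8\<rfloor> \<le> \<lfloor>chi G k l\<rfloor>" for l
      using chi_ge[OF fin nd] by (rule floor_mono)
  qed (use Z in auto)
  then show ?thesis
    by blast
qed

section \<open>Lattice cohomology\<close>

text \<open>The exponents \<open>n\<close> let one construction serve twice: with
  \<open>n = 0\<close> it extends cochains to chains, and with weight differences it is the inner
  sum of \<open>coboundary\<close>.\<close>

definition linear_extension :: "('c \<Rightarrow> nat) \<Rightarrow> ('c \<Rightarrow> T0) \<Rightarrow> ('c \<Rightarrow>\<^sub>0 int) \<Rightarrow> T0" where
  "linear_extension n f x = (\<Sum>c\<in>Poly_Mapping.keys x. monom_act (Poly_Mapping.lookup x c) (n c) (f c))"

lemma linear_extension_superset:
  assumes "finite S" "Poly_Mapping.keys x \<subseteq> S"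
  shows "linear_extension n f x = (\<Sum>c\<in>S. monom_act (Poly_Mapping.lookup x c) (n c) (f c))"
  unfolding linear_extension_def using assms
  by (intro sum.mono_neutral_left) (auto simp: in_keys_iff)

lemma linear_extension_add: "linear_extension n f (x + y) = linear_extension n f x + linear_extension n f y"
proof -
  have "Poly_Mapping.keys (x + y) \<subseteq> Poly_Mapping.keys x \<union> Poly_Mapping.keys y"
    by (rule Poly_Mapping.keys_add)
  then show ?thesis
    using linear_extension_superset[of "Poly_Mapping.keys x \<union> Poly_Mapping.keys y" _ n f]
    by (simp add: lookup_add monom_act_add_left sum.distrib)
qed

lemma linear_extension_0 [simp]: "linear_extension n f 0 = 0"
  by (simp add: linear_extension_def)

lemma linear_extension_minus: "linear_extension n f (- x) = - linear_extension n f x"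
  by (metis add.right_inverse add_eq_0_iff linear_extension_0 linear_extension_add)

lemma linear_extension_diff: "linear_extension n f (x - y) = linear_extension n f x - linear_extension n f y"
  using linear_extension_add[of n f x "- y"] by (simp add: linear_extension_minus)

lemma linear_extension_sum: "linear_extension n f (sum g A) = (\<Sum>i\<in>A. linear_extension n f (g i))"
  by (induction A rule: infinite_finite_induct) (auto simp: linear_extension_add)

lemma linear_extension_cmul: "linear_extension n f (frag_cmul a x) = monom_act a 0 (linear_extension n f x)"
proof -
  have "Poly_Mapping.keys (frag_cmul a x) \<subseteq> Poly_Mapping.keys x"
    by (rule keys_cmul)
  then show ?thesis
    using linear_extension_superset[of "Poly_Mapping.keys x" "frag_cmul a x" n f]
    by (simp add: linear_extension_def monom_act_sum monom_act_monom_act)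
qed

lemma linear_extension_of [simp]: "linear_extension n f (frag_of c) = monom_act 1 (n c) (f c)"
  by (simp add: linear_extension_def)

lemma linear_extension_cong:
  "(\<And>c. c \<in> Poly_Mapping.keys x \<Longrightarrow> f c = g c) \<Longrightarrow> linear_extension n f x = linear_extension n g x"
  by (simp add: linear_extension_def)

lemma carrier_chain_group: "carrier (chain_group G q) = {x. Poly_Mapping.keys x \<subseteq> cubes G q}"
  by (simp add: chain_group_def free_Abelian_group_def)

lemma mult_chain_group: "x \<otimes>\<^bsub>chain_group G q\<^esub> y = x + y"
  by (simp add: chain_group_def free_Abelian_group_def)

definition cochain :: "('v, 'b) plumbing_graph_scheme \<Rightarrow> nat \<Rightarrow> ('v cube \<Rightarrow> T0) \<Rightarrow> ('v cube \<Rightarrow>\<^sub>0 int) \<Rightarrow> T0" where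
  "cochain G q f = (\<lambda>x\<in>carrier (chain_group G q). linear_extension (\<lambda>_. 0) f x)"

lemma carrier_cochain_group:
  "\<phi> \<in> carrier (cochain_group G q) \<longleftrightarrow>
    (\<forall>x\<in>carrier (chain_group G q). \<forall>y\<in>carrier (chain_group G q). \<phi> (x + y) = \<phi> x + \<phi> y)
    \<and> \<phi> \<in> extensional (carrier (chain_group G q))"
  by (auto simp: cochain_group_def hom_def mult_chain_group T0_group_def)

lemma chain_add:
  "x \<in> carrier (chain_group G q) \<Longrightarrow> y \<in> carrier (chain_group G q) \<Longrightarrow> x + y \<in> carrier (chain_group G q)"
  using keys_add[of x y] by (auto simp: carrier_chain_group)

lemma mult_cochain_group: "\<phi> \<otimes>\<^bsub>cochain_group G q\<^esub> \<psi> = (\<lambda>x\<in>carrier (chain_group G q). \<phi> x + \<psi> x)"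
  by (simp add: cochain_group_def T0_group_def)

lemma one_cochain_group: "\<one>\<^bsub>cochain_group G q\<^esub> = (\<lambda>x\<in>carrier (chain_group G q). 0)"
  by (simp add: cochain_group_def T0_group_def)

lemma cochain_in_carrier: "cochain G q f \<in> carrier (cochain_group G q)"
  unfolding carrier_cochain_group by (auto simp: cochain_def linear_extension_add chain_add)

lemma cochain_of: "c \<in> cubes G q \<Longrightarrow> cochain G q f (frag_of c) = f c"
  by (simp add: cochain_def carrier_chain_group)

lemma cochain_cong: "(\<And>c. c \<in> cubes G q \<Longrightarrow> f c = g c) \<Longrightarrow> cochain G q f = cochain G q g"
  unfolding cochain_def by (intro restrict_ext linear_extension_cong) (auto simp: carrier_chain_group)

lemma cochain_frag_of:
  assumes \<phi>: "\<phi> \<in> carrier (cochain_group G q)"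
  shows "cochain G q (\<lambda>c. \<phi> (frag_of c)) = \<phi>"
proof
  fix x
  have add: "\<phi> (x + y) = \<phi> x + \<phi> y" if "x \<in> carrier (chain_group G q)" "y \<in> carrier (chain_group G q)" for x y
    using \<phi> that by (simp add: carrier_cochain_group)
  have zero: "\<phi> 0 = 0"
    using add[of 0 0] by (simp add: carrier_chain_group)
  show "cochain G q (\<lambda>c. \<phi> (frag_of c)) x = \<phi> x"
  proof (cases "x \<in> carrier (chain_group G q)")
    case True
    then have "Poly_Mapping.keys x \<subseteq> cubes G q"
      by (simp add: carrier_chain_group)
    then have "linear_extension (\<lambda>_. 0) (\<lambda>c. \<phi> (frag_of c)) x = \<phi> x \<and> x \<in> carrier (chain_group G q)"
    proof (induction x rule: frag_induction)
      case (one c)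
      then show ?case
        by (simp add: carrier_chain_group)
    next
      case (diff x y)
      have "x - y \<in> carrier (chain_group G q)"
        using diff keys_diff[of x y] by (auto simp: carrier_chain_group)
      moreover have "\<phi> (x - y) = \<phi> x - \<phi> y"
        using add[of "x - y" y] calculation diff by (simp add: algebra_simps)
      ultimately show ?case
        using diff by (simp add: linear_extension_diff)
    qed (simp add: zero carrier_chain_group)
    then show ?thesis
      using True by (simp add: cochain_def)
  next
    case False
    then show ?thesis
      using \<phi> by (simp add: cochain_def carrier_cochain_group extensional_def)
  qed
qed

section \<open>Cocycles as a group and the trivial quotient\<close>

lemma group_cocycles:
  assumes hom: "\<And>\<phi> \<psi>. \<phi> \<in> carrier (cochain_group G q) \<Longrightarrow> \<psi> \<in> carrier (cochain_group G q) \<Longrightarrow>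
    coboundary G k q (\<phi> \<otimes>\<^bsub>cochain_group G q\<^esub> \<psi>) = coboundary G k q \<phi> \<otimes>\<^bsub>cochain_group G (Suc q)\<^esub> coboundary G k q \<psi>"
  shows "group ((cochain_group G q)\<lparr>carrier := cocycles G k q\<rparr>)"
proof -
  let ?C = "cochain_group G q" and ?D = "cochain_group G (Suc q)"
  have mem: "\<phi> \<in> cocycles G k q \<longleftrightarrow> \<phi> \<in> carrier ?C \<and> coboundary G k q \<phi> = \<one>\<^bsub>?D\<^esub>" for \<phi>
    by (simp add: cocycles_def kernel_def)
  have C_mult: "\<phi> \<otimes>\<^bsub>?C\<^esub> \<psi> \<in> carrier ?C" if "\<phi> \<in> carrier ?C" "\<psi> \<in> carrier ?C" for \<phi> \<psi>
    using that by (auto simp: carrier_cochain_group mult_cochain_group chain_add)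
  have C_one: "\<one>\<^bsub>?C\<^esub> \<in> carrier ?C"
    by (auto simp: carrier_cochain_group one_cochain_group chain_add)
  have C_one_mult: "\<one>\<^bsub>?C\<^esub> \<otimes>\<^bsub>?C\<^esub> \<phi> = \<phi>" if "\<phi> \<in> carrier ?C" for \<phi>
    using that by (auto simp: carrier_cochain_group mult_cochain_group one_cochain_group extensional_def fun_eq_iff)
  \<comment> \<open>Additivity shows that the coboundary of the neutral cochain equals its own
    double; pointwise cancellation in \<open>T0\<close> then makes it neutral.\<close>
  have idem: "y = \<one>\<^bsub>?D\<^esub>" if "y = y \<otimes>\<^bsub>?D\<^esub> y" for y
  proof
    fix x
    show "y x = \<one>\<^bsub>?D\<^esub> x"
      using fun_cong[OF that, of x] by (simp add: mult_cochain_group one_cochain_group split: if_splits)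
  qed
  have cob_one: "coboundary G k q \<one>\<^bsub>?C\<^esub> = \<one>\<^bsub>?D\<^esub>"
    using hom[OF C_one C_one] C_one_mult[OF C_one] by (intro idem) simp
  have D_one_mult: "\<one>\<^bsub>?D\<^esub> \<otimes>\<^bsub>?D\<^esub> \<one>\<^bsub>?D\<^esub> = \<one>\<^bsub>?D\<^esub>"
    by (auto simp: mult_cochain_group one_cochain_group)
  show ?thesis
  proof (rule groupI, simp_all)
    show "\<one>\<^bsub>?C\<^esub> \<in> cocycles G k q"
      using C_one cob_one by (simp add: mem)
    show "\<phi> \<otimes>\<^bsub>?C\<^esub> \<psi> \<in> cocycles G k q" if "\<phi> \<in> cocycles G k q" "\<psi> \<in> cocycles G k q" for \<phi> \<psi>
      using that C_mult hom D_one_mult by (simp add: mem)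
    show "\<one>\<^bsub>?C\<^esub> \<otimes>\<^bsub>?C\<^esub> \<phi> = \<phi>" if "\<phi> \<in> cocycles G k q" for \<phi>
      using that C_one_mult by (simp add: mem)
    show "\<phi> \<otimes>\<^bsub>?C\<^esub> \<psi> \<otimes>\<^bsub>?C\<^esub> \<rho> = \<phi> \<otimes>\<^bsub>?C\<^esub> (\<psi> \<otimes>\<^bsub>?C\<^esub> \<rho>)" for \<phi> \<psi> \<rho>
      by (auto simp: mult_cochain_group add.assoc)
    show "\<exists>\<psi>\<in>cocycles G k q. \<psi> \<otimes>\<^bsub>?C\<^esub> \<phi> = \<one>\<^bsub>?C\<^esub>" if \<phi>: "\<phi> \<in> cocycles G k q" for \<phi>
    proof
      define \<psi> where "\<psi> = (\<lambda>x\<in>carrier (chain_group G q). - \<phi> x)"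
      have \<psi>: "\<psi> \<in> carrier ?C"
        using \<phi> by (auto simp: mem carrier_cochain_group \<psi>_def chain_add)
      show inv: "\<psi> \<otimes>\<^bsub>?C\<^esub> \<phi> = \<one>\<^bsub>?C\<^esub>"
        by (auto simp: mult_cochain_group one_cochain_group \<psi>_def)
      have *: "coboundary G k q \<psi> \<otimes>\<^bsub>?D\<^esub> \<one>\<^bsub>?D\<^esub> = \<one>\<^bsub>?D\<^esub>"
        using hom[OF \<psi>, of \<phi>] \<phi> unfolding mem inv cob_one by metis
      have "coboundary G k q \<psi> = \<one>\<^bsub>?D\<^esub>"
      proof
        fix x
        show "coboundary G k q \<psi> x = \<one>\<^bsub>?D\<^esub> x"
        proof (cases "x \<in> carrier (chain_group G (Suc q))")
          case True
          then show ?thesis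
            using fun_cong[OF *, of x] by (simp add: mult_cochain_group one_cochain_group)
        next
          case False
          then show ?thesis
            by (simp add: one_cochain_group coboundary_def)
        qed
      qed
      with \<psi> show "\<psi> \<in> cocycles G k q"
        by (simp add: mem)
    qed
  qed
qed

lemma trivial_group_factor_self:
  assumes "group K"
  shows "trivial_group (K Mod (carrier K))"
proof -
  interpret group K by fact
  have sub: "subgroup (carrier K) K"
    by (rule subgroup_self)
  have "normal (carrier K) K"
    by (rule normal_invI[OF sub]) simp
  then have "group (K Mod (carrier K))"
    by (rule normal.factorgroup_is_group)
  moreover have "carrier (K Mod (carrier K)) = {\<one>\<^bsub>K Mod (carrier K)\<^esub>}"
  proof -
    have "rcosets\<^bsub>K\<^esub> (carrier K) = {carrier K}"
      using coset_join2[OF _ sub] one_closed unfolding RCOSETS_def by blast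
    then show ?thesis
      by (simp add: FactGroup_def)
  qed
  ultimately show ?thesis
    by (simp add: trivial_group_def)
qed

section \<open>Comparison of homomorphisms on chains with functions on cubes\<close>

lemma faces_in_cubes:
  assumes "c \<in> cubes G (Suc q)" "finite (verts G)" "i \<in> snd c"
  shows "(fst c, snd c - {i}) \<in> cubes G q" "((fst c)(i := fst c i + 1), snd c - {i}) \<in> cubes G q"
proof -
  obtain l I where c: "c = (l, I)" by (cases c)
  have "finite I"
    using assms(1,2) finite_subset by (auto simp: c cubes_def)
  then have "card (I - {i}) = q"
    using assms(1,3) by (simp add: c cubes_def)
  then show "(fst c, snd c - {i}) \<in> cubes G q" "((fst c)(i := fst c i + 1), snd c - {i}) \<in> cubes G q"
    using assms by (auto simp: c cubes_def int_lattice_def)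
qed

locale graph_weight =
  fixes G :: "('v::linorder, 'b) plumbing_graph_scheme" and k :: "'v \<Rightarrow> rat"
  assumes finite_verts: "finite (verts G)"
    and integral: "\<And>l. chi G k l = of_int \<lfloor>chi G k l\<rfloor>"
begin

abbreviation W :: "'v cube \<Rightarrow> int" where
  "W \<equiv> max_weight (\<lambda>l. \<lfloor>chi G k l\<rfloor>)"

sublocale weighted_cubes "verts G" W
  by (intro weighted_cubes_max_weight finite_verts)

lemma cube_verts_eq: "finite I \<Longrightarrow> cube_verts (l, I) = raise l ` Pow I"
proof -
  assume I: "finite I"
  have "(\<lambda>v. l v + (\<Sum>j\<in>I'. E j v)) = raise l I'" if "I' \<subseteq> I" for I'
  proof -
    have "finite I'"
      using that I finite_subset by auto
    then show ?thesis
      by (simp add: raise_def E_def)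
  qed
  then have "raise l ` Pow I = (\<lambda>I' v. l v + (\<Sum>j\<in>I'. E j v)) ` Pow I"
    by (intro image_cong) auto
  then show ?thesis
    unfolding cube_verts_def by auto
qed

lemma weight_eq: "finite I \<Longrightarrow> weight G k (l, I) = of_int (W (l, I))"
proof -
  assume I: "finite I"
  have "weight G k (l, I) = Max (rat_of_int ` (\<lambda>I'. \<lfloor>chi G k (raise l I')\<rfloor>) ` Pow I)"
    unfolding weight_def cube_verts_eq[OF I] image_image integral[symmetric] ..
  also have "\<dots> = of_int (W (l, I))"
    unfolding max_weight_def prod.case using I
    by (subst mono_Max_commute[of rat_of_int]) (auto simp: mono_def)
  finally show ?thesis .
qed

lemma linear_extension_boundary:
  assumes "finite I"
  shows "linear_extension (\<lambda>d. nat \<lfloor>weight G k (l, I) - weight G k d\<rfloor>) f (boundary (l, I)) = cobd f (l, I)"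
proof -
  have upd: "(\<lambda>v. l v + E i v) = l(i := l i + 1)" for i
    by (auto simp: E_def)
  have fin: "finite (I - {i})" for i
    using assms by simp
  show ?thesis
    unfolding boundary_def cobd_def prod.case linear_extension_sum linear_extension_cmul linear_extension_diff
      linear_extension_of upd weight_eq[OF assms] weight_eq[OF fin] of_int_diff[symmetric] floor_of_int sg_def ..
qed

lemma coboundary_eq:
  "coboundary G k q \<phi> = cochain G (Suc q) (cobd (\<lambda>c. \<phi> (frag_of c)))"
proof -
  have "coboundary G k q \<phi> = cochain G (Suc q) (\<lambda>c.
      linear_extension (\<lambda>d. nat \<lfloor>weight G k c - weight G k d\<rfloor>) (\<lambda>d. \<phi> (frag_of d)) (boundary c))"
    unfolding coboundary_def cochain_def linear_extension_def ..
  also have "\<dots> = cochain G (Suc q) (cobd (\<lambda>c. \<phi> (frag_of c)))"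
  proof (rule cochain_cong)
    fix c assume "c \<in> cubes G (Suc q)"
    then obtain l I where "c = (l, I)" "finite I"
      using finite_verts finite_subset by (auto simp: cubes_def)
    then show "linear_extension (\<lambda>d. nat \<lfloor>weight G k c - weight G k d\<rfloor>) (\<lambda>d. \<phi> (frag_of d)) (boundary c)
      = cobd (\<lambda>c. \<phi> (frag_of c)) c"
      by (simp only: linear_extension_boundary)
  qed
  finally show ?thesis .
qed

lemma face_in_cubes: "c \<in> cubes G (Suc q) \<Longrightarrow> is_face d c \<Longrightarrow> d \<in> cubes G q"
  using faces_in_cubes[OF _ finite_verts, of c q] by (auto simp: is_face_def)

lemma cobd_cong_cubes:
  assumes "c \<in> cubes G (Suc q)" "\<And>d. d \<in> cubes G q \<Longrightarrow> f d = g d"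
  shows "cobd f c = cobd g c"
  using assms by (intro cobd_cong) (auto dest: face_in_cubes)

lemma cobd_add: "cobd (\<lambda>c. f c + g c) c = cobd f c + cobd g c"
  using cobd_diff[of "\<lambda>c. f c + g c" g c] by simp

lemma coboundary_hom:
  assumes "\<phi> \<in> carrier (cochain_group G q)" "\<psi> \<in> carrier (cochain_group G q)"
  shows "coboundary G k q (\<phi> \<otimes>\<^bsub>cochain_group G q\<^esub> \<psi>) =
    coboundary G k q \<phi> \<otimes>\<^bsub>cochain_group G (Suc q)\<^esub> coboundary G k q \<psi>"
proof -
  have "coboundary G k q (\<phi> \<otimes>\<^bsub>cochain_group G q\<^esub> \<psi>) =
    cochain G (Suc q) (\<lambda>c. cobd (\<lambda>c. \<phi> (frag_of c)) c + cobd (\<lambda>c. \<psi> (frag_of c)) c)"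
    unfolding coboundary_eq cobd_add[symmetric]
    by (intro cochain_cong cobd_cong_cubes) (auto simp: mult_cochain_group carrier_chain_group)
  also have "\<dots> = coboundary G k q \<phi> \<otimes>\<^bsub>cochain_group G (Suc q)\<^esub> coboundary G k q \<psi>"
    unfolding coboundary_eq mult_cochain_group cochain_def
    by (intro restrict_ext) (simp add: linear_extension_def monom_act_add sum.distrib)
  finally show ?thesis .
qed

text \<open>A retraction onto base points vanishing outside the graph, as \<open>cubes\<close>
  requires but the abstract complex does not. Since \<open>chi\<close> ignores those coordinates,
  pulling back along \<open>restr\<close> extends a cocycle on \<open>cubes\<close> to a cocycle on
  all cubes.\<close>

definition restr :: "'v cube \<Rightarrow> 'v cube" where
  "restr = (\<lambda>(l, I). (\<lambda>v. if v \<in> verts G then l v else 0, I))"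

lemma W_restr:
  assumes "I \<subseteq> verts G"
  shows "W (restr (l, I)) = W (l, I)"
proof -
  have "chi G k (raise (\<lambda>v. if v \<in> verts G then l v else 0) I') = chi G k (raise l I')" if "I' \<subseteq> I" for I'
  proof -
    have "raise (\<lambda>v. if v \<in> verts G then l v else 0) I' = (\<lambda>v. if v \<in> verts G then raise l I' v else 0)"
      using that assms by (auto simp: raise_def fun_eq_iff)
    then show ?thesis
      by (simp only: chi_restrict)
  qed
  then show ?thesis
    unfolding restr_def max_weight_def prod.case by (intro arg_cong[where f = Max] image_cong refl) auto
qed

lemma cobd_restr:
  assumes I: "I \<subseteq> verts G"
  shows "cobd (\<lambda>c. f (restr c)) (restr (l, I)) = cobd (\<lambda>c. f (restr c)) (l, I)"
proof -
  define l' where "l' = (\<lambda>v. if v \<in> verts G then l v else 0)"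
  have r: "restr (l, J) = (l', J)" "restr (l', J) = (l', J)" for J
    by (auto simp: restr_def l'_def)
  have r1: "restr (l'(i := l' i + 1), J) = restr (l(i := l i + 1), J)" if "i \<in> I" for i J
    using that I by (auto simp: restr_def l'_def fun_eq_iff)
  have w: "W (l', J) = W (l, J)" if "J \<subseteq> verts G" for J
    using W_restr[OF that, of l] by (simp add: r)
  have w1: "W (l'(i := l' i + 1), I - {i}) = W (l(i := l i + 1), I - {i})" if "i \<in> I" for i
  proof -
    have "I - {i} \<subseteq> verts G"
      using I by auto
    from W_restr[OF this, of "l'(i := l' i + 1)"] W_restr[OF this, of "l(i := l i + 1)"] show ?thesis
      by (simp only: r1[OF that])
  qed
  show ?thesis
    unfolding r cobd_def prod.case
  proof (intro sum.cong refl)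
    fix i assume i: "i \<in> I"
    have "I - {i} \<subseteq> verts G"
      using I by auto
    then show "monom_act (sg I i) 0
      (monom_act 1 (nat (W (l', I) - W (l'(i := l' i + 1), I - {i}))) (f (restr (l'(i := l' i + 1), I - {i})))
      - monom_act 1 (nat (W (l', I) - W (l', I - {i}))) (f (l', I - {i})))
      = monom_act (sg I i) 0
      (monom_act 1 (nat (W (l, I) - W (l(i := l i + 1), I - {i}))) (f (restr (l(i := l i + 1), I - {i})))
      - monom_act 1 (nat (W (l, I) - W (l, I - {i}))) (f (l', I - {i})))"
      by (simp only: r1[OF i] w[OF I] w w1[OF i])
  qed
qed

lemma restr_cubes: "c \<in> cubes G q \<Longrightarrow> restr c = c"
  by (auto simp: cubes_def restr_def int_lattice_def)

lemma restr_in_cubes: "snd c \<subseteq> verts G \<Longrightarrow> restr c \<in> cubes G (card (snd c))"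
  by (cases c) (auto simp: cubes_def restr_def int_lattice_def)

lemma coboundaries_subset: "coboundary G k q ` carrier (cochain_group G q) \<subseteq> cocycles G k (Suc q)"
proof
  fix \<phi> assume "\<phi> \<in> coboundary G k q ` carrier (cochain_group G q)"
  then obtain \<psi> where \<phi>: "\<phi> = cochain G (Suc q) (cobd (\<lambda>c. \<psi> (frag_of c)))"
    by (auto simp: coboundary_eq)
  have "coboundary G k (Suc q) \<phi> = cochain G (Suc (Suc q)) (\<lambda>c. 0)"
    unfolding coboundary_eq
  proof (rule cochain_cong)
    fix c assume c: "c \<in> cubes G (Suc (Suc q))"
    have "cobd (\<lambda>c. \<phi> (frag_of c)) c = cobd (cobd (\<lambda>c. \<psi> (frag_of c))) c"
      using c by (rule cobd_cong_cubes) (simp add: \<phi> cochain_of)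
    also have "\<dots> = 0"
      using c by (intro cobd_cobd) (auto simp: cubes_def)
    finally show "cobd (\<lambda>c. \<phi> (frag_of c)) c = 0" .
  qed
  moreover have "cochain G (Suc (Suc q)) (\<lambda>c. 0) = \<one>\<^bsub>cochain_group G (Suc (Suc q))\<^esub>"
    by (simp add: cochain_def one_cochain_group linear_extension_def)
  ultimately show "\<phi> \<in> cocycles G k (Suc q)"
    using cochain_in_carrier[of G "Suc q"] by (simp add: cocycles_def kernel_def \<phi>)
qed

lemma cocycles_subset:
  assumes vanishing: "\<And>\<phi>. cocycle (Suc q) \<phi> \<Longrightarrow>
    \<exists>\<psi>. \<forall>c. snd c \<subseteq> verts G \<and> card (snd c) = Suc q \<longrightarrow> cobd \<psi> c = \<phi> c"
  shows "cocycles G k (Suc q) \<subseteq> coboundary G k q ` carrier (cochain_group G q)"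
proof
  fix \<phi> assume "\<phi> \<in> cocycles G k (Suc q)"
  then have \<phi>: "\<phi> \<in> carrier (cochain_group G (Suc q))"
    and cob: "coboundary G k (Suc q) \<phi> = \<one>\<^bsub>cochain_group G (Suc (Suc q))\<^esub>"
    by (auto simp: cocycles_def kernel_def)
  define f where "f = (\<lambda>c. \<phi> (frag_of (restr c)))"
  have f_cubes: "f c = \<phi> (frag_of c)" if "c \<in> cubes G r" for c r
    by (simp add: f_def restr_cubes[OF that])
  have zero: "cobd f c = 0" if c: "c \<in> cubes G (Suc (Suc q))" for c
  proof -
    have "cobd f c = cobd (\<lambda>c. \<phi> (frag_of c)) c"
      using c f_cubes by (rule cobd_cong_cubes)
    also have "\<dots> = coboundary G k (Suc q) \<phi> (frag_of c)"
      using c by (simp add: coboundary_eq cochain_of)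
    also have "\<dots> = 0"
      unfolding cob one_cochain_group using c by (simp add: carrier_chain_group)
    finally show ?thesis .
  qed
  have "cocycle (Suc q) f"
    unfolding cocycle_def
  proof (intro allI impI, elim conjE)
    fix c :: "'v cube" assume c: "snd c \<subseteq> verts G" "card (snd c) = Suc (Suc q)"
    have "cobd f c = cobd f (restr c)"
      unfolding f_def using cobd_restr[of "snd c" "\<lambda>c. \<phi> (frag_of c)" "fst c"] c(1) by simp
    then show "cobd f c = 0"
      using zero[of "restr c"] restr_in_cubes[OF c(1)] c(2) by simp
  qed
  then obtain \<psi> where \<psi>: "\<And>c. snd c \<subseteq> verts G \<Longrightarrow> card (snd c) = Suc q \<Longrightarrow> cobd \<psi> c = f c"
    using vanishing by blast
  have "coboundary G k q (cochain G q \<psi>) = cochain G (Suc q) (\<lambda>c. \<phi> (frag_of c))"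
    unfolding coboundary_eq
  proof (rule cochain_cong)
    fix c assume c: "c \<in> cubes G (Suc q)"
    have "cobd (\<lambda>c. cochain G q \<psi> (frag_of c)) c = cobd \<psi> c"
      using c by (rule cobd_cong_cubes) (rule cochain_of)
    also have "\<dots> = \<phi> (frag_of c)"
      using \<psi>[of c] f_cubes[OF c] c by (auto simp: cubes_def)
    finally show "cobd (\<lambda>c. cochain G q \<psi> (frag_of c)) c = \<phi> (frag_of c)" .
  qed
  also have "\<dots> = \<phi>"
    by (rule cochain_frag_of[OF \<phi>])
  finally show "\<phi> \<in> coboundary G k q ` carrier (cochain_group G q)"
    using cochain_in_carrier by blast
qed

lemma trivial_lattice_cohomology:
  assumes "\<And>\<phi>. cocycle (Suc q) \<phi> \<Longrightarrow>
    \<exists>\<psi>. \<forall>c. snd c \<subseteq> verts G \<and> card (snd c) = Suc q \<longrightarrow> cobd \<psi> c = \<phi> c"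
  shows "trivial_group (lattice_cohomology G k (Suc q))"
proof -
  have "coboundaries G k (Suc q) = cocycles G k (Suc q)"
    using coboundaries_subset cocycles_subset[OF assms] by auto
  then show ?thesis
    using trivial_group_factor_self[OF group_cocycles[OF coboundary_hom, of "Suc q"]]
    by (simp add: lattice_cohomology_def)
qed

end

theorem corollary3p3p6:
  fixes G :: "'v::linorder plumbing_graph" and \<nu> :: nat
  assumes "1 \<le> \<nu>"
    and "plumbing_tree G" and "negative_definite G"
    and "has_bad_vertices G \<nu>"
  shows "\<forall>q\<ge>\<nu>. \<forall>k\<in>characteristic_elements G. trivial_group (lattice_cohomology G k q)"
proof (intro allI impI ballI)
  fix q k assume q: "\<nu> \<le> q" and k: "k \<in> characteristic_elements G"
  have fin: "finite (verts G)"
    using assms(2) by (rule plumbing_tree.finite_verts)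
  obtain B e' where B: "B \<subseteq> verts G" "card B = \<nu>" "\<forall>j. j \<notin> B \<longrightarrow> e' j = euler G j"
    "rational_graph (G\<lparr>euler := e'\<rparr>)"
    using assms(4) by (auto simp: has_bad_vertices_def)
  obtain Z m where "negative_lattice_weight (verts G) B (entry G) (\<lambda>v. \<lfloor>chi G k (E v)\<rfloor>) (\<lambda>l. \<lfloor>chi G k l\<rfloor>) Z m"
    using negative_lattice_weight_graph[OF fin assms(3) k B(1,3,4)] by blast
  then interpret lat: negative_lattice_weight "verts G" B "entry G" "\<lambda>v. \<lfloor>chi G k (E v)\<rfloor>" "\<lambda>l. \<lfloor>chi G k l\<rfloor>"
    "\<lambda>l v. \<Sum>u\<in>verts G. l u * entry G u v" Z m .
  interpret graph_weight G k
    using fin chi_integral[OF k] by unfold_locales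
  \<comment> \<open>\<open>1 \<le> \<nu>\<close> enters twice: the degree is positive, so
    coboundaries are images, and \<open>B\<close> is nonempty, which supplies a direction to
    integrate along.\<close>
  obtain q' where q': "q = Suc q'"
    using q assms(1) by (cases q) auto
  have "B \<noteq> {}" "card B \<le> q"
    using assms(1) B(2) q by auto
  then show "trivial_group (lattice_cohomology G k q)"
    unfolding q' by (intro trivial_lattice_cohomology lat.vanishing) auto
qed

end
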